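(* Let $n$ be a positive integer and let $p,q$ be real numbers with $1<p<n$ and $\frac{(n+1)(p-1)}{n+1-p}<q<\frac{np-n+p}{n-p}$. Put $\alpha_{p,q}=\frac{p}{q+1-p}$ and $\lambda_{p,q}=\alpha_{p,q}(n+1-\alpha_{p,q}q)$. Then any positive solution $\omega$ of $$\operatorname{div}\left((\alpha_{p,q}^2\omega^2+|\nabla\omega|^2)^{\frac{p-2}{2}}\nabla\omega\right)+|\omega|^{q-1}\omega-\lambda_{p,q}(\alpha_{p,q}^2\omega^2+|\nabla\omega|^2)^{\frac{p-2}{2}}\omega=0\quad\text{on }\mathbb{S}^n$$ is constant.
   Context: $\mathbb{S}^n$ is the unit $n$-sphere with its canonical metric; $\operatorname{div}$, $\nabla$ and $|\cdot|$ are taken with respect to this metric. *)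

theory Defs
  imports "HOL-Analysis.Analysis"
begin

text \<open>
  The unit \<open>n\<close>-sphere is \<^term>\<open>sphere 0 1\<close> in a Euclidean space of dimension \<open>n + 1\<close>, with the
  metric induced by the inner product. Its tangent space at \<open>x\<close> is the orthogonal complement
  of \<open>x\<close>.
\<close>

definition tangent_proj :: "'a::euclidean_space \<Rightarrow> 'a \<Rightarrow> 'a" where
  "tangent_proj x v = v - (v \<bullet> x) *\<^sub>R x"

text \<open>
  The differential of a map on the sphere. A Frechet derivative within the sphere is determined
  on tangent vectors only (see \<open>sphere_deriv_eq\<close> below), so its argument is projected first. Thus
  \<open>sphere_deriv f x\<close> is the differential on tangent vectors and vanishes on the normal line.
\<close>

definition sphere_deriv :: "('a::euclidean_space \<Rightarrow> 'b::real_normed_vector) \<Rightarrow> 'a \<Rightarrow> 'a \<Rightarrow> 'b" where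
  "sphere_deriv f x v = frechet_derivative f (at x within sphere 0 1) (tangent_proj x v)"

text \<open>
  Class \<open>C^k\<close> on the sphere: the tangent fields \<open>x \<mapsto> tangent_proj x v\<close> are smooth and span every
  tangent space, so it suffices to differentiate along them.
\<close>

primrec sphere_Ck :: "nat \<Rightarrow> ('a::euclidean_space \<Rightarrow> 'b::real_normed_vector) \<Rightarrow> bool" where
  "sphere_Ck 0 f \<longleftrightarrow> continuous_on (sphere 0 1) f"
| "sphere_Ck (Suc k) f \<longleftrightarrow>
     f differentiable_on sphere 0 1 \<and> (\<forall>v. sphere_Ck k (\<lambda>x. sphere_deriv f x v))"

definition sphere_grad :: "('a::euclidean_space \<Rightarrow> real) \<Rightarrow> 'a \<Rightarrow> 'a" where
  "sphere_grad f x = (THE g. g \<bullet> x = 0 \<and> (\<forall>v. v \<bullet> x = 0 \<longrightarrow> g \<bullet> v = sphere_deriv f x v))"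

text \<open>
  The Levi-Civita connection of the induced metric is the tangential part of the ambient
  derivative.
\<close>

definition sphere_cov_deriv :: "('a::euclidean_space \<Rightarrow> 'a) \<Rightarrow> 'a \<Rightarrow> 'a \<Rightarrow> 'a" where
  "sphere_cov_deriv X x v = tangent_proj x (sphere_deriv X x v)"

text \<open>
  The divergence is the trace of the endomorphism \<open>v \<mapsto> sphere_cov_deriv X x v\<close> of the tangent
  space. This map vanishes on the normal line, so its trace may be computed in the ambient space
  (see \<open>sphere_div_eq\<close> below).
\<close>

definition sphere_div :: "('a::euclidean_space \<Rightarrow> 'a) \<Rightarrow> 'a \<Rightarrow> real" where
  "sphere_div X x = (\<Sum>b\<in>Basis. sphere_cov_deriv X x b \<bullet> b)"

definition alpha :: "real \<Rightarrow> real \<Rightarrow> real" where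
  "alpha p q = p / (q + 1 - p)"

definition lambda :: "nat \<Rightarrow> real \<Rightarrow> real \<Rightarrow> real" where
  "lambda n p q = alpha p q * (real n + 1 - alpha p q * q)"


lemma tangent_proj_tangent: "v \<bullet> x = 0 \<Longrightarrow> tangent_proj x v = v"
  by (simp add: tangent_proj_def)

lemma tangent_proj_orth: "norm x = 1 \<Longrightarrow> tangent_proj x v \<bullet> x = 0"
  by (simp add: tangent_proj_def inner_diff_left dot_square_norm)

lemma linear_tangent_proj: "linear (tangent_proj x)"
  by (rule linearI) (simp_all add: tangent_proj_def algebra_simps inner_add_left)

lemma sphere_tangent_derivative_unique:
  fixes f :: "'a::euclidean_space \<Rightarrow> 'b::real_normed_vector"
  assumes "norm x = 1" "v \<bullet> x = 0"
    and "(f has_derivative L) (at x within sphere 0 1)"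
    and "(f has_derivative M) (at x within sphere 0 1)"
  shows "L v = M v"
proof (cases "v = 0")
  case True
  then show ?thesis
    using assms(3,4) by (simp add: has_derivative_bounded_linear linear_simps(3))
next
  case False
  define u where "u = v /\<^sub>R norm v"
  define c where "c = (\<lambda>t::real. cos t *\<^sub>R x + sin t *\<^sub>R u)"
  have u: "u \<bullet> u = 1" "u \<bullet> x = 0" and v: "v = norm v *\<^sub>R u"
    using False assms(2) by (auto simp: u_def dot_square_norm power2_eq_square)
  have xx: "x \<bullet> x = 1"
    using assms(1) by (simp add: dot_square_norm)
  have cS: "c ` UNIV \<subseteq> sphere 0 1"
  proof (clarsimp simp: norm_eq_1 c_def)
    fix t :: real
    have "(cos t *\<^sub>R x + sin t *\<^sub>R u) \<bullet> (cos t *\<^sub>R x + sin t *\<^sub>R u) = cos t * cos t + sin t * sin t"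
      using u xx by (simp add: inner_add_left inner_add_right inner_commute)
    then show "(cos t *\<^sub>R x + sin t *\<^sub>R u) \<bullet> (cos t *\<^sub>R x + sin t *\<^sub>R u) = 1"
      using sin_cos_squared_add3[of t] by simp
  qed
  have c0: "c 0 = x"
    by (simp add: c_def)
  have dc: "(c has_derivative (\<lambda>t. t *\<^sub>R u)) (at 0)"
    unfolding c_def by (auto intro!: derivative_eq_intros)
  have comp: "((\<lambda>t. f (c t)) has_derivative (\<lambda>t. K (t *\<^sub>R u))) (at 0)"
    if "(f has_derivative K) (at x within sphere 0 1)" for K
    using has_derivative_in_compose[OF dc, of f K] has_derivative_subset[OF that cS] c0 by simp
  have "(\<lambda>t. L (t *\<^sub>R u)) = (\<lambda>t. M (t *\<^sub>R u))"
    by (rule has_derivative_unique[OF comp[OF assms(3)] comp[OF assms(4)]])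
  then show ?thesis
    using v by metis
qed

lemma sphere_deriv_eq:
  fixes f :: "'a::euclidean_space \<Rightarrow> 'b::real_normed_vector"
  assumes "norm x = 1" "(f has_derivative L) (at x within sphere 0 1)"
  shows "sphere_deriv f x v = L (tangent_proj x v)"
  unfolding sphere_deriv_def
  using assms tangent_proj_orth[OF assms(1)]
  by (intro sphere_tangent_derivative_unique[of x _ f])
     (auto simp: frechet_derivative_works[symmetric] differentiable_def)

lemma sphere_grad_inner:
  fixes f :: "'a::euclidean_space \<Rightarrow> real"
  assumes "norm x = 1" "f differentiable (at x within sphere 0 1)"
  shows "sphere_grad f x \<bullet> x = 0" "sphere_grad f x \<bullet> v = sphere_deriv f x v"
proof -
  obtain L where L: "(f has_derivative L) (at x within sphere 0 1)"
    using assms(2) by (auto simp: differentiable_def)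
  have lin: "linear (\<lambda>v. L (tangent_proj x v))"
    using linear_compose[OF linear_tangent_proj has_derivative_linear[OF L]] by (simp add: o_def)
  define g where "g = (\<Sum>b\<in>Basis. L (tangent_proj x b) *\<^sub>R b)"
  have g: "g \<bullet> w = L (tangent_proj x w)" for w
  proof -
    have "L (tangent_proj x w) = L (tangent_proj x (\<Sum>b\<in>Basis. (w \<bullet> b) *\<^sub>R b))"
      by (simp add: euclidean_representation)
    also have "\<dots> = (\<Sum>b\<in>Basis. (w \<bullet> b) * L (tangent_proj x b))"
      unfolding linear_sum[OF lin] linear_cmul[OF lin] by simp
    finally show ?thesis
      unfolding g_def inner_sum_left by (simp add: inner_commute[of _ w] mult.commute)
  qed
  have px: "tangent_proj x x = 0"
    using assms(1) by (simp add: tangent_proj_def dot_square_norm)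
  have gx: "g \<bullet> x = 0"
    using g[of x] px linear_0[OF has_derivative_linear[OF L]] by simp
  have d: "sphere_deriv f x w = g \<bullet> w" for w
    using sphere_deriv_eq[OF assms(1) L] g by simp
  have "sphere_grad f x = g"
    unfolding sphere_grad_def
  proof (rule the_equality)
    show "g \<bullet> x = 0 \<and> (\<forall>v. v \<bullet> x = 0 \<longrightarrow> g \<bullet> v = sphere_deriv f x v)"
      using gx d by simp
    fix h
    assume h: "h \<bullet> x = 0 \<and> (\<forall>v. v \<bullet> x = 0 \<longrightarrow> h \<bullet> v = sphere_deriv f x v)"
    have "(h - g) \<bullet> x = 0"
      using h gx by (simp add: inner_diff_left)
    then have "(h - g) \<bullet> (h - g) = 0"
      using h d[of "h - g"] by (simp add: inner_diff_left)
    then show "h = g"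
      by simp
  qed
  then show "sphere_grad f x \<bullet> x = 0" "sphere_grad f x \<bullet> v = sphere_deriv f x v"
    using gx d by simp_all
qed

lemma sphere_div_eq:
  fixes X :: "'a::euclidean_space \<Rightarrow> 'a"
  assumes "norm x = 1" "(X has_derivative L) (at x within sphere 0 1)"
    and B: "pairwise orthogonal B" "\<And>b. b \<in> B \<Longrightarrow> norm b = 1" "span B = {v. v \<bullet> x = 0}"
  shows "sphere_div X x = (\<Sum>b\<in>B. L b \<bullet> b)"
proof -
  have indB: "independent B"
    using B(1,2) pairwise_orthogonal_independent by force
  have fin: "finite B"
    using indB independent_imp_finite by blast
  have bb: "b \<bullet> c = (if b = c then 1 else 0)" if "b \<in> B" "c \<in> B" for b c
    using B(1,2) that by (auto simp: pairwise_def orthogonal_def norm_eq_1)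
  have bx: "b \<bullet> x = 0" if "b \<in> B" for b
    using B(3) span_base[OF that] by auto
  have expand: "tangent_proj x w = (\<Sum>b\<in>B. (w \<bullet> b) *\<^sub>R b)" for w
  proof -
    let ?d = "tangent_proj x w - (\<Sum>b\<in>B. (w \<bullet> b) *\<^sub>R b)"
    have "?d \<in> span B"
    proof (rule span_diff)
      show "tangent_proj x w \<in> span B"
        using tangent_proj_orth[OF assms(1)] B(3) by simp
      show "(\<Sum>b\<in>B. (w \<bullet> b) *\<^sub>R b) \<in> span B"
        by (intro span_sum span_scale span_base)
    qed
    moreover have "orthogonal ?d c" if "c \<in> B" for c
    proof -
      have "(\<Sum>b\<in>B. (w \<bullet> b) *\<^sub>R b) \<bullet> c = (\<Sum>b\<in>B. if b = c then w \<bullet> b else 0)"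
        unfolding inner_sum_left by (rule sum.cong) (auto simp: bb that)
      also have "\<dots> = w \<bullet> c"
        using fin that by simp
      finally show ?thesis
        using bx[OF that]
        unfolding orthogonal_def inner_diff_left tangent_proj_def by (simp add: inner_commute[of x])
    qed
    ultimately have "orthogonal ?d ?d"
      using orthogonal_to_span by blast
    then show ?thesis
      by (simp add: orthogonal_def)
  qed
  have lin: "linear L"
    by (rule has_derivative_linear[OF assms(2)])
  have "sphere_cov_deriv X x i \<bullet> i = (\<Sum>b\<in>B. (i \<bullet> b) * (tangent_proj x (L b) \<bullet> i))" for i
  proof -
    have "linear (\<lambda>w. tangent_proj x (L w))"
      using linear_compose[OF lin linear_tangent_proj] by (simp add: o_def)
    note l = linear_sum[OF this] linear_cmul[OF this]
    show ?thesis
      unfolding sphere_cov_deriv_def sphere_deriv_eq[OF assms(1,2)] expand[of i] l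
      by (simp add: inner_sum_left)
  qed
  then have "sphere_div X x = (\<Sum>b\<in>B. \<Sum>i\<in>Basis. (i \<bullet> b) * (tangent_proj x (L b) \<bullet> i))"
    unfolding sphere_div_def by (simp add: sum.swap[of _ Basis B])
  also have "\<dots> = (\<Sum>b\<in>B. tangent_proj x (L b) \<bullet> b)"
    by (rule sum.cong[OF refl], subst euclidean_inner) (simp add: inner_commute mult.commute)
  also have "\<dots> = (\<Sum>b\<in>B. L b \<bullet> b)"
    by (rule sum.cong) (auto simp: tangent_proj_def inner_diff_left bx inner_commute[of x])
  finally show ?thesis .
qed

end

theory Submission
  imports Defs
begin

text \<open>
  Write \<open>\<omega> = f powr (- \<alpha>)\<close> on the sphere, with \<open>f\<close> extended to the punctured space as a function
  homogeneous of degree one. Put \<open>G = \<nabla>f\<close>, \<open>F = |G|\<^sup>p\<close>, \<open>H = |G| powr (p - 2) G\<close>,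
  \<open>m = (\<alpha> + 1) (p - 1)\<close> and \<open>k = \<alpha> powr (1 - p)\<close>. The equation becomes
  \<open>div H = (m F + k) / f\<close>, and the bounds on \<open>q\<close> become \<open>n (p - 1) / p < m < n\<close>.

  The Hessian of \<open>f\<close> annihilates the position vector, so \<open>DH\<close> has rank at most \<open>n\<close> and
  \<open>tr ((DH)\<^sup>2) \<ge> (div H)\<^sup>2 / n\<close>. Divergences of vector fields homogeneous of degree \<open>-n\<close>
  integrate to zero over the sphere, and for \<open>X = f powr (1 - n) H\<close> the integrals of \<open>tr (DX DH)\<close> and
  \<open>div X div H\<close> agree. With \<open>K = k - (n - m) F\<close> this gives
  \<open>\<integral> f powr (- n - 1) K = 0\<close> and then \<open>\<integral> f powr (- n - 1) K\<^sup>2 \<le> 0\<close>, so that \<open>|G|\<close> is constant.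
  By Euler's identity \<open>f = G \<bullet> x \<le> |G|\<close> on the sphere, with equality at a minimum of \<open>f\<close>, hence \<open>f\<close> is constant.

  Since \<open>\<omega>\<close> is only of class \<open>C\<^sup>2\<close>, \<open>H\<close> is only of class \<open>C\<^sup>1\<close>, and the trace identity is obtained
  from difference quotients.
\<close>

section \<open>Maps continuously differentiable off the origin\<close>

text \<open>Degree one is chosen because Euler's identity makes \<open>f\<close> the radial part of
  \<open>G\<close> on the sphere: the squared norm of \<open>G\<close> is the sum of the squares of
  \<open>f\<close> and of its tangential gradient, so the two terms under the power in the equation
  merge into one norm. The argument then runs in flat space, and no curvature term appears; the
  geometry of the sphere enters through the kernel of the Hessian, which improves the constant of
  the trace inequality from \<open>DIM('a)\<close> to n. Two obstacles remain. The map DH need not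
  be symmetric, but it is a positive map composed with a symmetric one, hence as good as symmetric
  for traces. And the trace identity leaves the derivative of F along H, a term without a sign; a
  further divergence, that of f powr (-n) F H, expresses it through K. What is left is a quadratic
  polynomial in K, whose linear part has integral zero. Surface measure is avoided: integrals are
  taken over an annulus against a radial weight, and the terms in which a derivative falls on the
  weight vanish by dilation invariance.\<close>

definition C1_off0 :: "('a::euclidean_space \<Rightarrow> 'b::real_normed_vector) \<Rightarrow> ('a \<Rightarrow> 'a \<Rightarrow> 'b) \<Rightarrow> bool" where
  "C1_off0 f f' \<longleftrightarrow> (\<forall>x. x \<noteq> 0 \<longrightarrow> (f has_derivative f' x) (at x)) \<and>
     (\<forall>v. continuous_on (- {0}) (\<lambda>x. f' x v))"

lemma C1_off0_derivative: "C1_off0 f f' \<Longrightarrow> x \<noteq> 0 \<Longrightarrow> (f has_derivative f' x) (at x)"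
  by (simp add: C1_off0_def)

lemma C1_off0_linear: "C1_off0 f f' \<Longrightarrow> x \<noteq> 0 \<Longrightarrow> linear (f' x)"
  using C1_off0_derivative has_derivative_linear by blast

lemma C1_off0_continuous: "C1_off0 f f' \<Longrightarrow> continuous_on (- {0}) f"
  unfolding C1_off0_def
  by (rule has_derivative_continuous_on[of _ _ f']) (simp add: has_derivative_at_withinI)

text \<open>\<open>C1_off0\<close> asks for continuity of the derivative at fixed vectors only.
  Expansion in the basis upgrades this to a moving direction, such as \<open>H x\<close> in
  \<open>F' x (H x)\<close>.\<close>

lemma C1_off0_continuous_apply:
  fixes f :: "'a::euclidean_space \<Rightarrow> 'b::real_normed_vector"
  assumes f: "C1_off0 f f'" and v: "continuous_on (- {0}) v"
  shows "continuous_on (- {0}) (\<lambda>x. f' x (v x))"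
proof (rule continuous_on_eq)
  show "continuous_on (- {0}) (\<lambda>x. \<Sum>c\<in>Basis. (v x \<bullet> c) *\<^sub>R f' x c)"
    using f by (intro continuous_intros v) (auto simp: C1_off0_def)
  show "(\<Sum>c\<in>Basis. (v x \<bullet> c) *\<^sub>R f' x c) = f' x (v x)" if "x \<in> - {0}" for x
  proof -
    have "f' x (v x) = f' x (\<Sum>c\<in>Basis. (v x \<bullet> c) *\<^sub>R c)" by (simp add: euclidean_representation)
    also have "\<dots> = (\<Sum>c\<in>Basis. (v x \<bullet> c) *\<^sub>R f' x c)"
      using C1_off0_linear[OF f] that by (simp add: linear_sum linear_cmul)
    finally show ?thesis by simp
  qed
qed

lemma C1_off0_cong_derivative:
  assumes f: "C1_off0 f f'" and eq: "\<And>x v. x \<noteq> 0 \<Longrightarrow> f' x v = g' x v"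
  shows "C1_off0 f g'"
  unfolding C1_off0_def
proof (intro conjI allI impI)
  show "(f has_derivative g' x) (at x)" if "x \<noteq> 0" for x
    using C1_off0_derivative[OF f that] eq[OF that] by (metis ext)
  show "continuous_on (- {0}) (\<lambda>x. g' x v)" for v
    by (rule continuous_on_eq[of _ "\<lambda>x. f' x v"]) (use f eq in \<open>auto simp: C1_off0_def\<close>)
qed

lemma C1_off0_const: "C1_off0 (\<lambda>x. c) (\<lambda>x v. 0)"
  by (simp add: C1_off0_def)

lemma C1_off0_ident: "C1_off0 (\<lambda>x. x) (\<lambda>x v. v)"
  by (simp add: C1_off0_def)

lemma C1_off0_add:
  assumes "C1_off0 f f'" "C1_off0 g g'"
  shows "C1_off0 (\<lambda>x. f x + g x) (\<lambda>x v. f' x v + g' x v)"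
  using assms unfolding C1_off0_def by (auto intro!: has_derivative_add continuous_on_add)

lemma C1_off0_diff:
  assumes "C1_off0 f f'" "C1_off0 g g'"
  shows "C1_off0 (\<lambda>x. f x - g x) (\<lambda>x v. f' x v - g' x v)"
  using assms unfolding C1_off0_def by (auto intro!: has_derivative_diff continuous_on_diff)

lemma C1_off0_sum:
  assumes "\<And>i. i \<in> I \<Longrightarrow> C1_off0 (f i) (f' i)"
  shows "C1_off0 (\<lambda>x. \<Sum>i\<in>I. f i x) (\<lambda>x v. \<Sum>i\<in>I. f' i x v)"
  using assms unfolding C1_off0_def by (auto intro!: has_derivative_sum continuous_on_sum)

lemma C1_off0_scaleR:
  fixes a :: "'a::euclidean_space \<Rightarrow> real" and X :: "'a \<Rightarrow> 'b::real_normed_vector"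
  assumes "C1_off0 a a'" "C1_off0 X X'"
  shows "C1_off0 (\<lambda>x. a x *\<^sub>R X x) (\<lambda>x v. a x *\<^sub>R X' x v + a' x v *\<^sub>R X x)"
  unfolding C1_off0_def
proof (intro conjI allI impI)
  show "((\<lambda>x. a x *\<^sub>R X x) has_derivative (\<lambda>v. a x *\<^sub>R X' x v + a' x v *\<^sub>R X x)) (at x)" if "x \<noteq> 0" for x
    using assms that by (intro has_derivative_scaleR C1_off0_derivative)
  show "continuous_on (- {0}) (\<lambda>x. a x *\<^sub>R X' x v + a' x v *\<^sub>R X x)" for v
    using assms
    by (intro continuous_on_add continuous_on_scaleR C1_off0_continuous[OF assms(1)] C1_off0_continuous[OF assms(2)])
      (auto simp: C1_off0_def)
qed

lemma C1_off0_powr: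
  fixes a :: "'a::euclidean_space \<Rightarrow> real"
  assumes a: "C1_off0 a a'" and pos: "\<And>x. x \<noteq> 0 \<Longrightarrow> a x > 0"
  shows "C1_off0 (\<lambda>x. a x powr s) (\<lambda>x v. s * a x powr (s - 1) * a' x v)"
  unfolding C1_off0_def
proof (intro conjI allI impI)
  show "((\<lambda>x. a x powr s) has_derivative (\<lambda>v. s * a x powr (s - 1) * a' x v)) (at x)" if "x \<noteq> 0" for x
  proof -
    have "((\<lambda>y. y powr s) has_derivative (\<lambda>h. h * (s * a x powr (s - 1)))) (at (a x))"
      using has_real_derivative_powr[OF pos[OF that], of s]
      by (simp add: has_field_derivative_def mult_commute_abs)
    from has_derivative_compose[OF C1_off0_derivative[OF a that] this]
    show ?thesis by (simp add: mult_ac)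
  qed
  show "continuous_on (- {0}) (\<lambda>x. s * a x powr (s - 1) * a' x v)" for v
    using a by (intro continuous_intros continuous_on_powr C1_off0_continuous[OF a])
      (auto simp: C1_off0_def dest: pos)
qed

lemma C1_off0_norm:
  fixes X :: "'a::euclidean_space \<Rightarrow> 'b::real_inner"
  assumes X: "C1_off0 X X'" and nz: "\<And>x. x \<noteq> 0 \<Longrightarrow> X x \<noteq> 0"
  shows "C1_off0 (\<lambda>x. norm (X x)) (\<lambda>x v. (X x \<bullet> X' x v) / norm (X x))"
  unfolding C1_off0_def
proof (intro conjI allI impI)
  show "((\<lambda>x. norm (X x)) has_derivative (\<lambda>v. (X x \<bullet> X' x v) / norm (X x))) (at x)" if "x \<noteq> 0" for x
  proof -
    have "(norm has_derivative (\<lambda>h. h \<bullet> sgn (X x))) (at (X x))"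
      using has_derivative_norm[OF nz[OF that]] by simp
    from has_derivative_compose[OF C1_off0_derivative[OF X that] this]
    show ?thesis by (simp add: sgn_div_norm inner_commute divide_inverse mult.commute)
  qed
  show "continuous_on (- {0}) (\<lambda>x. (X x \<bullet> X' x v) / norm (X x))" for v
    using X by (intro continuous_intros C1_off0_continuous[OF X]) (auto simp: C1_off0_def nz)
qed

lemma C1_off0_inner_const:
  fixes X :: "'a::euclidean_space \<Rightarrow> 'b::real_inner"
  assumes X: "C1_off0 X X'"
  shows "C1_off0 (\<lambda>x. X x \<bullet> b) (\<lambda>x v. X' x v \<bullet> b)"
  using X unfolding C1_off0_def
  by (auto intro!: has_derivative_inner_left continuous_intros)

lemma C1_off0_norm_powr_scaleR:
  fixes G :: "'a::euclidean_space \<Rightarrow> 'a"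
  assumes G: "C1_off0 G S" and nz: "\<And>x. x \<noteq> 0 \<Longrightarrow> G x \<noteq> 0"
  shows "C1_off0 (\<lambda>x. norm (G x) powr r *\<^sub>R G x)
    (\<lambda>x v. norm (G x) powr r *\<^sub>R S x v + (r * norm (G x) powr (r - 1) * ((G x \<bullet> S x v) / norm (G x))) *\<^sub>R G x)"
  by (intro C1_off0_scaleR C1_off0_powr[OF C1_off0_norm[OF G nz]] G) (use nz in auto)

section \<open>Homogeneous functions and Euler's identities\<close>

lemma derivative_homogeneous:
  fixes f :: "'a::euclidean_space \<Rightarrow> 'b::real_normed_vector"
  assumes "C1_off0 f f'" "l > 0" "x \<noteq> 0"
    and hom: "\<And>x. x \<noteq> 0 \<Longrightarrow> c *\<^sub>R f (l *\<^sub>R x) = f x"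
  shows "(c * l) *\<^sub>R f' (l *\<^sub>R x) v = f' x v"
proof -
  have 1: "(f has_derivative f' (l *\<^sub>R x)) (at (l *\<^sub>R x))" and 2: "(f has_derivative f' x) (at x)"
    using assms(1-3) unfolding C1_off0_def by auto
  have "((\<lambda>x. c *\<^sub>R f (l *\<^sub>R x)) has_derivative (\<lambda>v. c *\<^sub>R f' (l *\<^sub>R x) (l *\<^sub>R v))) (at x)"
    by (intro has_derivative_scaleR_right has_derivative_compose[where f="\<lambda>x. l *\<^sub>R x" and g=f, OF _ 1])
      (auto intro!: derivative_eq_intros)
  then have "(f has_derivative (\<lambda>v. c *\<^sub>R f' (l *\<^sub>R x) (l *\<^sub>R v))) (at x)"
    by (rule has_derivative_transform_within_open[where s="- {0}"]) (use hom assms(3) in auto)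
  then have "f' x v = c *\<^sub>R f' (l *\<^sub>R x) (l *\<^sub>R v)"
    using has_derivative_unique[OF 2] by metis
  also have "\<dots> = (c * l) *\<^sub>R f' (l *\<^sub>R x) v"
    using has_derivative_linear[OF 1] by (simp add: linear_cmul)
  finally show ?thesis by simp
qed

lemma gradient_homogeneous_1:
  fixes f :: "'a::euclidean_space \<Rightarrow> real"
  assumes f: "C1_off0 f (\<lambda>x v. G x \<bullet> v)"
    and hom: "\<And>l x. l > 0 \<Longrightarrow> x \<noteq> 0 \<Longrightarrow> f (l *\<^sub>R x) = l * f x"
    and "l > 0" "x \<noteq> 0"
  shows "G (l *\<^sub>R x) = G x"
proof -
  have "(1 / l * l) *\<^sub>R (G (l *\<^sub>R x) \<bullet> v) = G x \<bullet> v" for v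
    by (rule derivative_homogeneous[OF f assms(3,4)]) (use hom[OF assms(3)] assms(3) in auto)
  then have "(G (l *\<^sub>R x) - G x) \<bullet> v = 0" for v
    using assms(3) by (simp add: inner_diff_left)
  then show ?thesis using inner_eq_zero_iff[of "G (l *\<^sub>R x) - G x"] by simp
qed

lemma euler_homogeneous_1:
  fixes f :: "'a::euclidean_space \<Rightarrow> real"
  assumes f: "C1_off0 f f'"
    and hom: "\<And>l x. l > 0 \<Longrightarrow> x \<noteq> 0 \<Longrightarrow> f (l *\<^sub>R x) = l * f x" and x: "x \<noteq> 0"
  shows "f' x x = f x"
proof -
  have "((\<lambda>t. f (t *\<^sub>R x)) has_derivative (\<lambda>h. f' (1 *\<^sub>R x) (h *\<^sub>R x))) (at 1)"
    by (rule has_derivative_compose[of "\<lambda>t. t *\<^sub>R x"])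
      (use C1_off0_derivative[OF f] x in \<open>auto intro!: derivative_eq_intros\<close>)
  moreover have "((\<lambda>t. t * f x) has_derivative (\<lambda>h. h * f x)) (at 1)"
    by (auto intro!: derivative_eq_intros)
  then have "((\<lambda>t. f (t *\<^sub>R x)) has_derivative (\<lambda>h. h * f x)) (at 1)"
    by (rule has_derivative_transform_within_open[where s="{0<..}"]) (use hom x in auto)
  ultimately have "(\<lambda>h. f' (1 *\<^sub>R x) (h *\<^sub>R x)) = (\<lambda>h. h * f x)"
    by (rule has_derivative_unique)
  from fun_cong[OF this, of 1] show ?thesis by simp
qed

text \<open>Applied to the gradient of a function of degree one, this puts \<open>x\<close> into the
  kernel of the Hessian.\<close>

lemma euler_homogeneous_0:
  fixes f :: "'a::euclidean_space \<Rightarrow> 'b::real_normed_vector"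
  assumes f: "C1_off0 f f'"
    and hom: "\<And>l x. l > 0 \<Longrightarrow> x \<noteq> 0 \<Longrightarrow> f (l *\<^sub>R x) = f x" and x: "x \<noteq> 0"
  shows "f' x x = 0"
proof -
  have "((\<lambda>t. f (t *\<^sub>R x)) has_derivative (\<lambda>h. f' (1 *\<^sub>R x) (h *\<^sub>R x))) (at 1)"
    by (rule has_derivative_compose[of "\<lambda>t. t *\<^sub>R x"])
      (use C1_off0_derivative[OF f] x in \<open>auto intro!: derivative_eq_intros\<close>)
  moreover have "((\<lambda>t. f (t *\<^sub>R x)) has_derivative (\<lambda>h. 0)) (at 1)"
    by (rule has_derivative_transform_within_open[where s="{0<..}" and f="\<lambda>_. f x"]) (use hom x in auto)
  ultimately have "(\<lambda>h. f' (1 *\<^sub>R x) (h *\<^sub>R x)) = (\<lambda>h. 0)"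
    by (rule has_derivative_unique)
  from fun_cong[OF this, of 1] show ?thesis by simp
qed

text \<open>The second difference over a small parallelogram is symmetric in its two sides. The mean
  value theorem along one side leaves a difference of two gradients, and both are expanded about
  \<open>x\<close>, the one point where \<open>G\<close> is assumed differentiable.\<close>

lemma second_derivative_symmetric:
  fixes f :: "'a::real_inner \<Rightarrow> real"
  assumes r: "r > 0" and f: "\<And>y. y \<in> ball x r \<Longrightarrow> (f has_derivative (\<lambda>v. G y \<bullet> v)) (at y)"
    and G: "(G has_derivative S) (at x)"
  shows "S u \<bullet> v = u \<bullet> S v"
proof -
  have linS: "linear S" using G by (rule has_derivative_linear)
  define K where "K = norm u + norm v"
  have main: "\<bar>S v \<bullet> u - S u \<bullet> v\<bar> \<le> \<epsilon> * (4 * K * K)" if \<epsilon>: "\<epsilon> > 0" for \<epsilon>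
  proof -
    obtain d where d: "d > 0" "\<And>y. norm (y - x) < d \<Longrightarrow> norm (G y - G x - S (y - x)) \<le> \<epsilon> * norm (y - x)"
      using G \<epsilon> unfolding has_derivative_at_alt by blast
    \<comment> \<open>The parallelogram with sides \<open>t *\<^sub>R u\<close> and
      \<open>t *\<^sub>R v\<close> then lies within both radii; the \<open>+ 1\<close> keeps the
      denominator positive when \<open>K = 0\<close>.\<close>
    define t where "t = min d r / (2 * (K + 1))"
    have K0: "K \<ge> 0" by (simp add: K_def)
    have t0: "t > 0" using d r K0 by (simp add: t_def)
    have "t * K < min d r"
    proof -
      have "t * (2 * (K + 1)) = min d r" using K0 by (simp add: t_def)
      moreover have "t * K < t * (2 * (K + 1))" using t0 K0 by (intro mult_strict_left_mono) auto
      ultimately show ?thesis by simp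
    qed
    then have tK: "t * K < d" "t * K < r" by auto
    define \<Delta> where "\<Delta> = f (x + t *\<^sub>R u + t *\<^sub>R v) - f (x + t *\<^sub>R u) - f (x + t *\<^sub>R v) + f x"
    \<comment> \<open>The local \<open>u\<close> and \<open>v\<close> shadow the outer ones, so the
      estimate applies to both orders of the sides. Both approximate the same
      \<open>\<Delta>\<close>, which compares the two mixed terms.\<close>
    have claim: "\<bar>\<Delta>' - t * t * (S v \<bullet> u)\<bar> \<le> t * t * \<epsilon> * (2 * K * K)"
      if uv: "norm u + norm v = K" 
        and \<Delta>': "\<Delta>' = f (x + t *\<^sub>R u + t *\<^sub>R v) - f (x + t *\<^sub>R u) - f (x + t *\<^sub>R v) + f x" for u v \<Delta>'
    proof -
      define g where "g = (\<lambda>s. f (x + s *\<^sub>R u + t *\<^sub>R v) - f (x + s *\<^sub>R u))"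
      have near: "norm (s *\<^sub>R u + t *\<^sub>R v) \<le> t * K" "norm (s *\<^sub>R u) \<le> t * K" if "0 \<le> s" "s \<le> t" for s
      proof -
        have su: "s * norm u \<le> t * norm u" using that by (intro mult_right_mono) auto
        have "norm (s *\<^sub>R u + t *\<^sub>R v) \<le> s * norm u + t * norm v"
          using norm_triangle_ineq[of "s *\<^sub>R u" "t *\<^sub>R v"] that t0 by simp
        then show "norm (s *\<^sub>R u + t *\<^sub>R v) \<le> t * K"
          using su uv by (simp add: algebra_simps uv[symmetric])
        have "t * norm u \<le> t * K" using t0 uv by (intro mult_left_mono) (auto simp: uv[symmetric])
        then show "norm (s *\<^sub>R u) \<le> t * K" using su that by simp
      qed
      have gd: "(g has_real_derivative (G (x + s *\<^sub>R u + t *\<^sub>R v) - G (x + s *\<^sub>R u)) \<bullet> u) (at s)"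
        if "0 \<le> s" "s \<le> t" for s
      proof -
        have 1: "(f has_derivative (\<lambda>w. G (x + s *\<^sub>R u + t *\<^sub>R v) \<bullet> w)) (at (x + s *\<^sub>R u + t *\<^sub>R v))"
        proof (rule f)
          have "dist x (x + (s *\<^sub>R u + t *\<^sub>R v)) = norm (s *\<^sub>R u + t *\<^sub>R v)"
            by (metis add_diff_cancel_left' dist_commute dist_norm)
          then show "x + s *\<^sub>R u + t *\<^sub>R v \<in> ball x r"
            unfolding add.assoc mem_ball using near(1)[OF that] tK(2) by linarith
        qed
        have 2: "(f has_derivative (\<lambda>w. G (x + s *\<^sub>R u) \<bullet> w)) (at (x + s *\<^sub>R u))"
          by (rule f) (use near(2)[OF that] tK(2) in \<open>simp add: dist_norm\<close>)
        have "(g has_derivative (\<lambda>h. G (x + s *\<^sub>R u + t *\<^sub>R v) \<bullet> (h *\<^sub>R u) - G (x + s *\<^sub>R u) \<bullet> (h *\<^sub>R u))) (at s)"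
          unfolding g_def
          by (intro has_derivative_diff has_derivative_compose[where f="\<lambda>s. x + s *\<^sub>R u + t *\<^sub>R v" and g=f, OF _ 1]
              has_derivative_compose[where f="\<lambda>s. x + s *\<^sub>R u" and g=f, OF _ 2])
            (auto intro!: derivative_eq_intros)
        then show ?thesis unfolding has_field_derivative_def
          by (rule has_derivative_eq_rhs) (auto simp: inner_diff_left algebra_simps)
      qed
      obtain \<xi> where \<xi>: "0 < \<xi>" "\<xi> < t"
        and eq: "g t - g 0 = (t - 0) * ((G (x + \<xi> *\<^sub>R u + t *\<^sub>R v) - G (x + \<xi> *\<^sub>R u)) \<bullet> u)"
        using MVT2[OF t0, of g "\<lambda>s. (G (x + s *\<^sub>R u + t *\<^sub>R v) - G (x + s *\<^sub>R u)) \<bullet> u"] gd by blast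
      define e1 where "e1 = G (x + (\<xi> *\<^sub>R u + t *\<^sub>R v)) - G x - S (\<xi> *\<^sub>R u + t *\<^sub>R v)"
      define e2 where "e2 = G (x + \<xi> *\<^sub>R u) - G x - S (\<xi> *\<^sub>R u)"
      have n: "norm (\<xi> *\<^sub>R u + t *\<^sub>R v) \<le> t * K" "norm (\<xi> *\<^sub>R u) \<le> t * K"
        using near[of \<xi>] \<xi> by auto
      have "norm e1 \<le> \<epsilon> * norm (\<xi> *\<^sub>R u + t *\<^sub>R v)" "norm e2 \<le> \<epsilon> * norm (\<xi> *\<^sub>R u)"
        unfolding e1_def e2_def
        using d(2)[of "x + (\<xi> *\<^sub>R u + t *\<^sub>R v)"] d(2)[of "x + \<xi> *\<^sub>R u"] n tK(1) by simp_all
      then have e12: "norm e1 \<le> \<epsilon> * (t * K)" "norm e2 \<le> \<epsilon> * (t * K)"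
        using n \<epsilon> by (meson mult_left_mono less_imp_le order_trans)+
      have "S (\<xi> *\<^sub>R u + t *\<^sub>R v) - S (\<xi> *\<^sub>R u) = t *\<^sub>R S v"
        using linS by (simp add: linear_add linear_cmul)
      then have "G (x + \<xi> *\<^sub>R u + t *\<^sub>R v) - G (x + \<xi> *\<^sub>R u) = t *\<^sub>R S v + (e1 - e2)"
        unfolding e1_def e2_def by (simp add: algebra_simps)
      moreover have "g t - g 0 = \<Delta>'" unfolding g_def \<Delta>' by simp
      ultimately have "\<Delta>' = t * ((t *\<^sub>R S v + (e1 - e2)) \<bullet> u)"
        using eq by simp
      then have "\<Delta>' - t * t * (S v \<bullet> u) = t * ((e1 - e2) \<bullet> u)"
        unfolding inner_add_left by (simp add: algebra_simps)
      moreover have "\<bar>(e1 - e2) \<bullet> u\<bar> \<le> (2 * (\<epsilon> * (t * K))) * K"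
      proof -
        have "\<bar>(e1 - e2) \<bullet> u\<bar> \<le> norm (e1 - e2) * norm u" by (rule Cauchy_Schwarz_ineq2)
        also have "\<dots> \<le> (2 * (\<epsilon> * (t * K))) * K"
        proof (rule mult_mono)
          show "norm (e1 - e2) \<le> 2 * (\<epsilon> * (t * K))"
            using norm_triangle_ineq4[of e1 e2] e12 by linarith
          show "norm u \<le> K" unfolding uv[symmetric] by simp
        qed (use \<epsilon> t0 K0 in auto)
        finally show ?thesis .
      qed
      then have "t * \<bar>(e1 - e2) \<bullet> u\<bar> \<le> t * ((2 * (\<epsilon> * (t * K))) * K)"
        using t0 by (intro mult_left_mono) auto
      ultimately show ?thesis using t0 by (simp add: abs_mult mult_ac)
    qed
    have "\<bar>\<Delta> - t * t * (S v \<bullet> u)\<bar> \<le> t * t * \<epsilon> * (2 * K * K)"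
      by (rule claim) (simp_all add: K_def \<Delta>_def)
    moreover have "\<bar>\<Delta> - t * t * (S u \<bullet> v)\<bar> \<le> t * t * \<epsilon> * (2 * K * K)"
      by (rule claim) (simp_all add: K_def \<Delta>_def add_ac)
    ultimately have "\<bar>t * t * (S v \<bullet> u) - t * t * (S u \<bullet> v)\<bar> \<le> t * t * \<epsilon> * (2 * K * K) + t * t * \<epsilon> * (2 * K * K)"
      by linarith
    also have "\<dots> = (t * t) * (\<epsilon> * (4 * K * K))" by (simp add: algebra_simps)
    also have "t * t * (S v \<bullet> u) - t * t * (S u \<bullet> v) = (t * t) * (S v \<bullet> u - S u \<bullet> v)"
      by (simp add: algebra_simps)
    finally have "(t * t) * \<bar>S v \<bullet> u - S u \<bullet> v\<bar> \<le> (t * t) * (\<epsilon> * (4 * K * K))"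
      by (simp add: abs_mult)
    then show ?thesis using t0 by (simp only: mult_le_cancel_left_pos mult_pos_pos)
  qed
  have "\<bar>S v \<bullet> u - S u \<bullet> v\<bar> \<le> 0"
  proof (rule field_le_epsilon)
    fix e :: real assume e: "e > 0"
    define C where "C = 4 * K * K + 1"
    have "0 \<le> 4 * K * K" by (simp add: K_def)
    then have C: "C > 0" "4 * K * K \<le> C" unfolding C_def by linarith+
    have "\<bar>S v \<bullet> u - S u \<bullet> v\<bar> \<le> (e / C) * (4 * K * K)" by (rule main) (use e C in auto)
    also have "\<dots> \<le> (e / C) * C" using e C by (intro mult_left_mono) auto
    finally show "\<bar>S v \<bullet> u - S u \<bullet> v\<bar> \<le> 0 + e" using C by simp
  qed
  then show ?thesis by (simp add: inner_commute)
qed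

section \<open>Traces\<close>

definition ltrace :: "('a::euclidean_space \<Rightarrow> 'a) \<Rightarrow> real" where
  "ltrace L = (\<Sum>b\<in>Basis. L b \<bullet> b)"

lemma ltrace_add: "ltrace (\<lambda>v. L v + M v) = ltrace L + ltrace M"
  by (simp add: ltrace_def inner_add_left sum.distrib)

lemma ltrace_scaleR: "ltrace (\<lambda>v. c *\<^sub>R L v) = c * ltrace L"
  by (simp add: ltrace_def sum_distrib_left)

lemma ltrace_rank_one:
  fixes h :: "'a::euclidean_space \<Rightarrow> real"
  assumes "linear h"
  shows "ltrace (\<lambda>v. h v *\<^sub>R w) = h w"
proof -
  have "h w = h (\<Sum>b\<in>Basis. (w \<bullet> b) *\<^sub>R b)" by (simp add: euclidean_representation)
  also have "\<dots> = (\<Sum>b\<in>Basis. (w \<bullet> b) * h b)"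
    using assms by (simp add: linear_sum linear_cmul)
  finally show ?thesis by (simp add: ltrace_def mult.commute)
qed

lemma inner_compose_expand:
  fixes L M :: "'a::euclidean_space \<Rightarrow> 'a"
  assumes "linear L"
  shows "L (M b) \<bullet> d = (\<Sum>c\<in>Basis. (M b \<bullet> c) * (L c \<bullet> d))"
proof -
  have "L (M b) = L (\<Sum>c\<in>Basis. (M b \<bullet> c) *\<^sub>R c)" by (simp add: euclidean_representation)
  also have "\<dots> = (\<Sum>c\<in>Basis. (M b \<bullet> c) *\<^sub>R L c)"
    using assms by (simp add: linear_sum linear_cmul)
  finally show ?thesis by (simp add: inner_sum_left)
qed

lemma ltrace_commute:
  fixes L M :: "'a::euclidean_space \<Rightarrow> 'a"
  assumes "linear L" "linear M"
  shows "ltrace (\<lambda>v. L (M v)) = ltrace (\<lambda>v. M (L v))"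
  unfolding ltrace_def inner_compose_expand[OF assms(1)] inner_compose_expand[OF assms(2)]
  by (subst sum.swap) (simp add: mult.commute)

text \<open>Cauchy-Schwarz for the Hilbert-Schmidt product of \<open>M\<close> with the orthogonal
  projection \<open>P\<close> along \<open>y\<close>. As \<open>M\<close> is symmetric and kills
  \<open>y\<close>, its trace is this product; the trace of the square is the squared norm of
  \<open>M\<close>, and the squared norm of \<open>P\<close> is its rank
  \<open>DIM('a) - 1\<close>.\<close>

lemma ltrace_square_symmetric:
  fixes M :: "'a::euclidean_space \<Rightarrow> 'a"
  assumes lin: "linear M" and sym: "\<And>u v. M u \<bullet> v = u \<bullet> M v" and y: "M y = 0" "y \<noteq> 0"
  shows "(ltrace M)\<^sup>2 \<le> (real DIM('a) - 1) * ltrace (\<lambda>v. M (M v))"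
proof -
  define P where "P = (\<lambda>u. u - ((u \<bullet> y) / (y \<bullet> y)) *\<^sub>R y)"
  have yy: "y \<bullet> y \<noteq> 0" using y by simp
  have 1: "ltrace M = (\<Sum>b\<in>Basis. M b \<bullet> P b)"
    unfolding ltrace_def P_def by (simp add: inner_diff_right sym y)
  have 2: "ltrace (\<lambda>v. M (M v)) = (\<Sum>b\<in>Basis. (norm (M b))\<^sup>2)"
    unfolding ltrace_def by (simp add: sym dot_square_norm[symmetric])
  have "(norm (P b))\<^sup>2 = b \<bullet> b - (y \<bullet> b)\<^sup>2 / (y \<bullet> y)" for b
    unfolding P_def dot_square_norm[symmetric] using yy
    by (simp add: inner_diff_left inner_diff_right inner_commute field_simps power2_eq_square)
  then have "(\<Sum>b\<in>Basis. (norm (P b))\<^sup>2) = (\<Sum>b\<in>(Basis::'a set). b \<bullet> b) - (\<Sum>b\<in>Basis. (y \<bullet> b)\<^sup>2) / (y \<bullet> y)"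
    by (simp add: sum_subtractf sum_divide_distrib)
  also have "(\<Sum>b\<in>Basis. (y \<bullet> b)\<^sup>2) = y \<bullet> y"
    by (subst euclidean_inner) (simp add: power2_eq_square)
  finally have 3: "(\<Sum>b\<in>Basis. (norm (P b))\<^sup>2) = real DIM('a) - 1" using yy by simp
  have "\<bar>ltrace M\<bar> \<le> (\<Sum>b\<in>Basis. norm (M b) * norm (P b))"
    unfolding 1 by (rule order_trans[OF sum_abs]) (intro sum_mono Cauchy_Schwarz_ineq2)
  then have "(ltrace M)\<^sup>2 \<le> (\<Sum>b\<in>Basis. norm (M b) * norm (P b))\<^sup>2"
    using power_mono[of "\<bar>ltrace M\<bar>" _ 2] by simp
  also have "\<dots> \<le> (\<Sum>b\<in>Basis. (norm (M b))\<^sup>2) * (\<Sum>b\<in>Basis. (norm (P b))\<^sup>2)"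
    by (rule Cauchy_Schwarz_ineq_sum)
  finally show ?thesis unfolding 2 3 by (simp add: mult.commute)
qed

text \<open>
  With \<open>A v = v + c (v \<bullet> e) e = B (B v)\<close>, the map \<open>A S\<close> has the same traces as the symmetric map
  \<open>B S B\<close>, which has a kernel.
\<close>

lemma ltrace_square_rank_one_perturbation:
  fixes S :: "'a::euclidean_space \<Rightarrow> 'a"
  assumes lin: "linear S" and sym: "\<And>u v. S u \<bullet> v = u \<bullet> S v" and x: "S x = 0" "x \<noteq> 0"
    and e: "norm e = 1" and c: "c > -1"
    and D: "D = (\<lambda>v. S v + (c * (S v \<bullet> e)) *\<^sub>R e)"
  shows "(ltrace D)\<^sup>2 \<le> (real DIM('a) - 1) * ltrace (\<lambda>v. D (D v))"
proof -
  \<comment> \<open>The map A stretches \<open>e\<close> by \<open>1 + c\<close>, so its positive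
    square root \<open>B\<close> stretches \<open>e\<close> by \<open>sqrt (1 + c)\<close>, and the
    inverse of \<open>B\<close> has the coefficient \<open>b'\<close>. The kernel vector of
    \<open>B S B\<close> is therefore the inverse image \<open>y\<close> of \<open>x\<close> under
    \<open>B\<close>.\<close>
  define b where "b = sqrt (1 + c) - 1"
  define b' where "b' = 1 / sqrt (1 + c) - 1"
  define B where "B = (\<lambda>v. v + (b * (v \<bullet> e)) *\<^sub>R e)"
  have ee: "e \<bullet> e = 1" using e by (simp add: dot_square_norm)
  have s: "sqrt (1 + c) > 0" using c by simp
  have bb: "2 * b + b\<^sup>2 = c"
    using c unfolding b_def by (simp add: power2_diff)
  have bb': "b + b' + b * b' = 0"
    using s unfolding b_def b'_def by (simp add: field_simps)
  have linB: "linear B"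
    unfolding B_def by (rule linearI) (auto simp: algebra_simps inner_add_left)
  have symB: "B u \<bullet> v = u \<bullet> B v" for u v
    unfolding B_def by (simp add: inner_add_left inner_add_right inner_commute)
  have BB: "B (B v) = v + (c * (v \<bullet> e)) *\<^sub>R e" for v
  proof -
    have "B (B v) = v + (b * (v \<bullet> e) + b * (v \<bullet> e + b * (v \<bullet> e))) *\<^sub>R e"
      unfolding B_def by (simp add: inner_add_left ee scaleR_left_distrib)
    also have "b * (v \<bullet> e) + b * (v \<bullet> e + b * (v \<bullet> e)) = (2 * b + b\<^sup>2) * (v \<bullet> e)"
      by (simp add: power2_eq_square algebra_simps)
    finally show ?thesis using bb by simp
  qed
  define y where "y = x + (b' * (x \<bullet> e)) *\<^sub>R e"
  have By: "B y = x"
  proof -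
    have "B y = x + (b' * (x \<bullet> e) + b * (x \<bullet> e + b' * (x \<bullet> e))) *\<^sub>R e"
      unfolding B_def y_def by (simp add: inner_add_left ee scaleR_left_distrib)
    also have "b' * (x \<bullet> e) + b * (x \<bullet> e + b' * (x \<bullet> e)) = (b + b' + b * b') * (x \<bullet> e)"
      by (simp add: algebra_simps)
    finally show ?thesis using bb' by simp
  qed
  define M where "M = (\<lambda>v. B (S (B v)))"
  have linBS: "linear (\<lambda>v. B (S v))" and linM: "linear M"
    using linear_compose[OF lin linB] linear_compose[OF linear_compose[OF linB lin] linB]
    by (simp_all add: o_def M_def)
  have DB: "D = (\<lambda>v. B (B (S v)))" unfolding D BB ..
  have t1: "ltrace D = ltrace M"
    unfolding DB M_def by (rule ltrace_commute[OF linB linBS])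
  have "linear (\<lambda>v. B (S (B (B (S v)))))"
    using linear_compose[OF linBS linear_compose[OF linB linBS]] by (simp add: o_def)
  from ltrace_commute[OF linB this]
  have t2: "ltrace (\<lambda>v. D (D v)) = ltrace (\<lambda>v. M (M v))"
    unfolding DB M_def .
  have "(ltrace M)\<^sup>2 \<le> (real DIM('a) - 1) * ltrace (\<lambda>v. M (M v))"
  proof (rule ltrace_square_symmetric[OF linM, of y])
    show "M u \<bullet> v = u \<bullet> M v" for u v
      unfolding M_def by (simp add: symB sym)
    show "M y = 0" unfolding M_def By x(1) using linB by (simp add: linear_0)
    show "y \<noteq> 0" using By x(2) linB linear_0 by metis
  qed
  then show ?thesis unfolding t1 t2 .
qed

lemma continuous_on_ltrace:
  assumes "\<And>b. continuous_on A (\<lambda>x. L x b)"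
  shows "continuous_on A (\<lambda>x. ltrace (L x))"
  unfolding ltrace_def by (intro continuous_intros assms)

section \<open>Integration by parts for homogeneous functions\<close>

lemma has_derivative_max0_square:
  "((\<lambda>s::real. (max 0 s)\<^sup>2) has_real_derivative 2 * max 0 s) (at s)"
proof -
  consider "s < 0" | "s > 0" | "s = 0" by linarith
  then show ?thesis
  proof cases
    case 1
    have "((\<lambda>s::real. 0) has_real_derivative 0) (at s)" by simp
    then have "((\<lambda>s::real. (max 0 s)\<^sup>2) has_real_derivative 0) (at s)"
      by (rule has_field_derivative_transform_within_open[where S="{..<0}"]) (use 1 in auto)
    then show ?thesis using 1 by simp
  next
    case 2
    have "((\<lambda>s::real. s\<^sup>2) has_real_derivative 2 * s) (at s)"
      by (auto intro!: derivative_eq_intros)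
    then have "((\<lambda>s::real. (max 0 s)\<^sup>2) has_real_derivative 2 * s) (at s)"
      by (rule has_field_derivative_transform_within_open[where S="{0<..}"]) (use 2 in auto)
    then show ?thesis using 2 by simp
  next
    case 3
    have "((\<lambda>h::real. (max 0 h)\<^sup>2 / h) \<longlongrightarrow> 0) (at 0)"
    proof (rule Lim_null_comparison[where g="\<lambda>h. \<bar>h\<bar>"])
      show "\<forall>\<^sub>F h::real in at 0. norm ((max 0 h)\<^sup>2 / h) \<le> \<bar>h\<bar>"
        by (rule always_eventually) (auto simp: max_def power2_eq_square)
      show "((\<lambda>h::real. \<bar>h\<bar>) \<longlongrightarrow> 0) (at 0)"
        by (intro tendsto_eq_intros) auto
    qed
    then show ?thesis
      unfolding 3 has_field_derivative_iff by simp
  qed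
qed

text \<open>The square of a positive part is already continuously differentiable, which is all the
  regularity used. Vanishing on the unit ball keeps the singularity of homogeneous functions at the
  origin out of the support.\<close>

definition cutoff :: "'a::euclidean_space \<Rightarrow> real" where
  "cutoff x = (max 0 ((x \<bullet> x - 1) * (4 - x \<bullet> x)))\<^sup>2"

text \<open>The scalar factor of the gradient, which is \<open>cutoff' x *\<^sub>R x\<close>. With s
  for \<open>x \<bullet> x\<close>, the derivative of (s - 1)(4 - s) is 5 - 2 s, and that of s along
  v is twice \<open>x \<bullet> v\<close>.\<close>

definition cutoff' :: "'a::euclidean_space \<Rightarrow> real" where
  "cutoff' x = 2 * max 0 ((x \<bullet> x - 1) * (4 - x \<bullet> x)) * (10 - 4 * (x \<bullet> x))"

lemma has_derivative_cutoff: "(cutoff has_derivative (\<lambda>v. cutoff' x * (x \<bullet> v))) (at x)"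
proof -
  have "((\<lambda>x::'a. (x \<bullet> x - 1) * (4 - x \<bullet> x)) has_derivative (\<lambda>v. (10 - 4 * (x \<bullet> x)) * (x \<bullet> v))) (at x)"
    by (auto intro!: derivative_eq_intros simp: algebra_simps inner_commute)
  from has_derivative_compose[OF this has_derivative_max0_square[unfolded has_field_derivative_def]]
  show ?thesis
    unfolding cutoff_def cutoff'_def by (simp add: mult.assoc)
qed

lemma cutoff_eq_0: assumes "norm x \<le> 1 \<or> norm x \<ge> 2" shows "cutoff x = 0" "cutoff' x = 0"
proof -
  have "(x \<bullet> x - 1) * (4 - x \<bullet> x) \<le> 0"
    using assms
  proof
    assume "norm x \<le> 1"
    then have "(norm x)\<^sup>2 \<le> 1\<^sup>2" by (intro power_mono) auto
    then show ?thesis unfolding dot_square_norm by (intro mult_nonpos_nonneg) auto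
  next
    assume "norm x \<ge> 2"
    then have "(norm x)\<^sup>2 \<ge> 2\<^sup>2" by (intro power_mono) auto
    then show ?thesis unfolding dot_square_norm by (intro mult_nonneg_nonpos) auto
  qed
  then have "max 0 ((x \<bullet> x - 1) * (4 - x \<bullet> x)) = 0" by simp
  then show "cutoff x = 0" "cutoff' x = 0" unfolding cutoff_def cutoff'_def by simp_all
qed

lemma cutoff_pos: assumes "1 < norm x" "norm x < 2" shows "cutoff x > 0"
proof -
  have "1\<^sup>2 < (norm x)\<^sup>2" "(norm x)\<^sup>2 < 2\<^sup>2" using assms by (intro power_strict_mono; simp)+
  then have "(x \<bullet> x - 1) * (4 - x \<bullet> x) > 0" unfolding dot_square_norm by (intro mult_pos_pos) auto
  then have "max 0 ((x \<bullet> x - 1) * (4 - x \<bullet> x)) > 0" by linarith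
  then show ?thesis unfolding cutoff_def by (rule zero_less_power)
qed

lemma continuous_cutoff: "continuous_on S cutoff" "continuous_on S cutoff'"
  unfolding cutoff_def[abs_def] cutoff'_def[abs_def] by (intro continuous_intros)+

lemma integrable_compact_support:
  fixes g :: "'a::euclidean_space \<Rightarrow> real"
  assumes "continuous_on UNIV g" "\<And>x. norm x > R \<Longrightarrow> g x = 0"
  shows "integrable lborel g"
proof -
  have "integrable lborel (\<lambda>x. indicator (cball 0 R) x *\<^sub>R g x)"
    by (rule borel_integrable_compact) (auto intro: continuous_on_subset[OF assms(1)])
  also have "(\<lambda>x. indicator (cball 0 R) x *\<^sub>R g x) = g"
    using assms(2) by (auto simp: indicator_def fun_eq_iff not_le)
  finally show ?thesis .
qed

lemma integrable_indicator_cball: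
  "integrable lborel (indicator (cball (x::'a::euclidean_space) r) :: 'a \<Rightarrow> real)"
  using emeasure_bounded_finite[OF bounded_cball, of x r] by (intro integrable_real_indicator) auto

lemma continuous_on_zero_near_0:
  fixes g :: "'a::euclidean_space \<Rightarrow> 'b::real_normed_vector"
  assumes "continuous_on (- {0}) g" "r > 0" "\<And>x. norm x < r \<Longrightarrow> g x = 0"
  shows "continuous_on UNIV g"
proof -
  have "continuous_on (- {0} \<union> ball 0 r) g"
  proof (rule continuous_on_open_Un)
    show "continuous_on (ball 0 r) g"
      by (rule continuous_on_eq[of _ "\<lambda>_. 0"]) (use assms(3) in auto)
  qed (use assms in auto)
  moreover have "- {0} \<union> ball 0 r = (UNIV::'a set)" using assms(2) by auto
  ultimately show ?thesis by simp
qed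

lemma derivative_zero_outside:
  fixes \<Phi> :: "'a::euclidean_space \<Rightarrow> real"
  assumes "(\<Phi> has_derivative L) (at x)" "\<And>y. norm y \<ge> R \<Longrightarrow> \<Phi> y = 0" "norm x > R"
  shows "L v = 0"
proof -
  have "(\<Phi> has_derivative (\<lambda>_. 0)) (at x)"
  proof (rule has_derivative_transform_within_open[where f="\<lambda>_. 0" and s="- cball 0 R"])
    show "x \<in> - cball 0 R" using assms(3) by auto
    show "0 = \<Phi> y" if "y \<in> - cball 0 R" for y
      using assms(2)[of y] that by auto
  qed auto
  then have "L = (\<lambda>_. 0)" using assms(1) has_derivative_unique by blast
  then show ?thesis by simp
qed

section \<open>Difference quotients of compactly supported functions\<close>

definition diff_quot :: "('a::euclidean_space \<Rightarrow> real) \<Rightarrow> 'a \<Rightarrow> real \<Rightarrow> 'a \<Rightarrow> real" where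
  "diff_quot \<Phi> e h x = (\<Phi> (x + h *\<^sub>R e) - \<Phi> x) / h"

locale C1_compact =
  fixes \<Phi> :: "'a::euclidean_space \<Rightarrow> real" and \<Phi>' :: "'a \<Rightarrow> 'a \<Rightarrow> real" and R :: real
  assumes der: "(\<Phi> has_derivative \<Phi>' x) (at x)"
    and cont: "continuous_on UNIV (\<lambda>x. \<Phi>' x v)"
    and supp: "norm x \<ge> R \<Longrightarrow> \<Phi> x = 0"
begin

lemma supp': "norm x > R \<Longrightarrow> \<Phi>' x v = 0"
  by (rule derivative_zero_outside[OF der, of R]) (use supp in auto)

lemma bounded_derivative: obtains B where "\<And>x. \<bar>\<Phi>' x e\<bar> \<le> B" "B \<ge> 0"
proof -
  have "compact ((\<lambda>x. \<Phi>' x e) ` cball 0 R)"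
    by (intro compact_continuous_image continuous_on_subset[OF cont]) auto
  then obtain B where B: "\<And>x. x \<in> cball 0 R \<Longrightarrow> norm (\<Phi>' x e) \<le> B"
    using compact_imp_bounded bounded_iff by (metis (no_types, lifting) image_eqI)
  show ?thesis
  proof (rule that[of "max 0 B"])
    show "\<bar>\<Phi>' x e\<bar> \<le> max 0 B" for x
    proof (cases "norm x \<le> R")
      case True then show ?thesis using B[of x] by auto
    next
      case False then show ?thesis using supp'[of x e] by auto
    qed
  qed auto
qed

lemma cont_fun: "continuous_on UNIV \<Phi>"
  using der has_derivative_continuous by (simp add: continuous_on_eq_continuous_within) blast

lemma cont_diff_quot: "continuous_on UNIV (diff_quot \<Phi> e h)"
  unfolding diff_quot_def[abs_def] divide_inverse
  by (intro continuous_intros continuous_on_compose2[OF cont_fun]) auto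

lemma diff_quot_bound:
  assumes "\<And>x. \<bar>\<Phi>' x e\<bar> \<le> B" "h \<noteq> 0"
  shows "\<bar>diff_quot \<Phi> e h x\<bar> \<le> B"
proof -
  define g where "g = (\<lambda>t. \<Phi> (x + t *\<^sub>R e))"
  have "(g has_derivative (\<lambda>s. \<Phi>' (x + t *\<^sub>R e) (s *\<^sub>R e))) (at t)" for t
    unfolding g_def
    by (rule has_derivative_compose[OF _ der]) (auto intro!: derivative_eq_intros)
  moreover have "\<Phi>' y (s *\<^sub>R e) = s * \<Phi>' y e" for y s
    using has_derivative_linear[OF der[of y]] by (simp add: linear_cmul)
  ultimately have gd: "(g has_real_derivative \<Phi>' (x + t *\<^sub>R e) e) (at t within UNIV)" for t
    by (simp add: has_field_derivative_def mult.commute[of _ "\<Phi>' _ e"] mult_commute_abs)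
  have "norm (g h - g 0) \<le> B * norm (h - 0)"
    by (rule field_differentiable_bound[OF _ gd]) (use assms in auto)
  then show ?thesis
    unfolding diff_quot_def g_def using assms(2) by (simp add: field_simps)
qed

lemma diff_quot_tendsto:
  assumes "(a \<longlongrightarrow> 0) F" "eventually (\<lambda>k. a k \<noteq> 0) F"
  shows "((\<lambda>k. diff_quot \<Phi> e (a k) x) \<longlongrightarrow> \<Phi>' x e) F"
proof -
  define g where "g = (\<lambda>t. \<Phi> (x + t *\<^sub>R e))"
  have "(g has_derivative (\<lambda>s. \<Phi>' (x + 0 *\<^sub>R e) (s *\<^sub>R e))) (at 0)"
    unfolding g_def
    by (rule has_derivative_compose[OF _ der]) (auto intro!: derivative_eq_intros)
  moreover have "\<Phi>' y (s *\<^sub>R e) = s * \<Phi>' y e" for y s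
    using has_derivative_linear[OF der[of y]] by (simp add: linear_cmul)
  ultimately have "(g has_real_derivative \<Phi>' x e) (at 0)"
    by (simp add: has_field_derivative_def mult.commute[of _ "\<Phi>' _ e"] mult_commute_abs)
  then have "((\<lambda>h. diff_quot \<Phi> e h x) \<longlongrightarrow> \<Phi>' x e) (at 0)"
    by (simp add: has_field_derivative_iff g_def diff_quot_def)
  moreover have "filterlim a (at 0) F"
    using assms by (simp add: filterlim_at)
  ultimately show ?thesis
    by (rule filterlim_compose)
qed

end

lemma lborel_translate:
  fixes g :: "'a::euclidean_space \<Rightarrow> real"
  assumes "g \<in> borel_measurable borel"
  shows "(\<integral>x. g (x + a) \<partial>lborel) = (\<integral>x. g x \<partial>lborel)"
proof -
  have "(\<integral>x. g x \<partial>lborel) = (\<integral>x. g x \<partial>(distr lborel borel ((+) a)))"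
    by (subst lborel_distr_plus) simp
  also have "\<dots> = (\<integral>x. g (a + x) \<partial>lborel)"
    by (rule integral_distr) (use assms in auto)
  finally show ?thesis by (simp add: add.commute)
qed

text \<open>Every difference quotient has integral zero by translation invariance, and dominated
  convergence passes to the derivative. Steps of size at most 1 keep all quotients inside one ball,
  of radius \<open>R + norm e\<close>.\<close>

lemma (in C1_compact) integral_partial_eq_0: "(\<integral>x. \<Phi>' x e \<partial>lborel) = 0"
proof -
  define a where "a = (\<lambda>k::nat. 1 / (real k + 1))"
  have a: "a \<longlonglongrightarrow> 0" "\<And>k. a k \<noteq> 0" "\<And>k. 0 < a k" "\<And>k. a k \<le> 1"
    unfolding a_def using LIMSEQ_inverse_real_of_nat by (auto simp: inverse_eq_divide add.commute)
  obtain B where B: "\<And>x. \<bar>\<Phi>' x e\<bar> \<le> B" "B \<ge> 0" using bounded_derivative by blast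
  have int: "integrable lborel \<Phi>"
    by (rule integrable_compact_support[OF cont_fun, of R]) (use supp in auto)
  have z: "(\<integral>x. diff_quot \<Phi> e (a k) x \<partial>lborel) = 0" for k
  proof -
    have meas: "\<Phi> \<in> borel_measurable borel"
      using cont_fun by (rule borel_measurable_continuous_onI)
    have "integrable lborel (\<lambda>x. \<Phi> (x + a k *\<^sub>R e))"
    proof (rule integrable_compact_support[of _ "R + norm (a k *\<^sub>R e)"])
      show "continuous_on UNIV (\<lambda>x. \<Phi> (x + a k *\<^sub>R e))"
        by (intro continuous_on_compose2[OF cont_fun] continuous_intros) auto
      fix x :: 'a assume "norm x > R + norm (a k *\<^sub>R e)"
      then have "norm (x + a k *\<^sub>R e) \<ge> R"
        using norm_diff_ineq[of x "a k *\<^sub>R e"] by linarith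
      then show "\<Phi> (x + a k *\<^sub>R e) = 0" by (rule supp)
    qed
    then have "(\<integral>x. diff_quot \<Phi> e (a k) x \<partial>lborel) = ((\<integral>x. \<Phi> (x + a k *\<^sub>R e) \<partial>lborel) - (\<integral>x. \<Phi> x \<partial>lborel)) / a k"
      unfolding diff_quot_def using int by simp
    then show ?thesis using lborel_translate[OF meas] by simp
  qed
  have "(\<lambda>k. \<integral>x. diff_quot \<Phi> e (a k) x \<partial>lborel) \<longlonglongrightarrow> (\<integral>x. \<Phi>' x e \<partial>lborel)"
  proof (rule integral_dominated_convergence[where w="\<lambda>x. B * indicator (cball 0 (R + norm e)) x"])
    show "integrable lborel (\<lambda>x::'a. B * indicator (cball 0 (R + norm e)) x)"
      by (intro integrable_mult_right integrable_indicator_cball)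
    show "AE x in lborel. (\<lambda>k. diff_quot \<Phi> e (a k) x) \<longlonglongrightarrow> \<Phi>' x e"
      by (intro AE_I2 diff_quot_tendsto) (use a in auto)
    show "AE x in lborel. norm (diff_quot \<Phi> e (a k) x) \<le> B * indicator (cball 0 (R + norm e)) x" for k
    proof (rule AE_I2)
      fix x :: 'a
      show "norm (diff_quot \<Phi> e (a k) x) \<le> B * indicator (cball 0 (R + norm e)) x"
      proof (cases "norm x \<le> R + norm e")
        case True
        then show ?thesis using diff_quot_bound[OF B(1) a(2)] by simp
      next
        case False
        have "norm (a k *\<^sub>R e) \<le> norm e" using a(3,4)[of k] by (simp add: mult_left_le_one_le)
        then have "norm (x + a k *\<^sub>R e) \<ge> R" "norm x \<ge> R"
          using norm_diff_ineq[of x "a k *\<^sub>R e"] False norm_ge_zero[of e] by linarith+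
        then have "diff_quot \<Phi> e (a k) x = 0" by (simp add: diff_quot_def supp)
        then show ?thesis using B by simp
      qed
    qed
  qed (auto intro!: borel_measurable_continuous_onI cont cont_diff_quot)
  then show ?thesis using z LIMSEQ_unique[OF _ tendsto_const] by simp
qed

text \<open>
  Translations commute and preserve Lebesgue measure, so the identity holds for difference
  quotients; in this way no second derivatives are needed.
\<close>

lemma integral_partials_swap:
  fixes \<Phi> \<Psi> :: "'a::euclidean_space \<Rightarrow> real"
  assumes "C1_compact \<Phi> \<Phi>' R" "C1_compact \<Psi> \<Psi>' R"
  shows "(\<integral>x. \<Phi>' x e * \<Psi>' x d \<partial>lborel) = (\<integral>x. \<Phi>' x d * \<Psi>' x e \<partial>lborel)"
proof -
  interpret F: C1_compact \<Phi> \<Phi>' R by fact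
  interpret P: C1_compact \<Psi> \<Psi>' R by fact
  have meas: "\<Phi> \<in> borel_measurable borel" "\<Psi> \<in> borel_measurable borel"
    using F.cont_fun P.cont_fun by (auto intro: borel_measurable_continuous_onI)
  \<comment> \<open>The bound on \<open>a\<close> confines the support through the first factor. The
    signs of the steps are left free, because the limit is taken both along \<open>a k\<close> and
    along \<open>- a k\<close>.\<close>
  have conv: "(\<lambda>k. \<integral>x. diff_quot \<Phi> e (a k) x * diff_quot \<Psi> d (b k) x \<partial>lborel) \<longlonglongrightarrow> (\<integral>x. \<Phi>' x e * \<Psi>' x d \<partial>lborel)"
    if a: "a \<longlonglongrightarrow> 0" "\<And>k. a k \<noteq> 0" "\<And>k. \<bar>a k\<bar> \<le> 1" and b: "b \<longlonglongrightarrow> 0" "\<And>k. b k \<noteq> 0" for a b e d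
  proof -
    obtain B where B: "\<And>x. \<bar>\<Phi>' x e\<bar> \<le> B" "B \<ge> 0" using F.bounded_derivative by blast
    obtain C where C: "\<And>x. \<bar>\<Psi>' x d\<bar> \<le> C" "C \<ge> 0" using P.bounded_derivative by blast
    show ?thesis
    proof (rule integral_dominated_convergence[where w="\<lambda>x. B * C * indicator (cball 0 (R + norm e)) x"])
      show "integrable lborel (\<lambda>x::'a. B * C * indicator (cball 0 (R + norm e)) x)"
        by (intro integrable_mult_right integrable_indicator_cball)
      show "AE x in lborel. (\<lambda>k. diff_quot \<Phi> e (a k) x * diff_quot \<Psi> d (b k) x) \<longlonglongrightarrow> \<Phi>' x e * \<Psi>' x d"
        by (intro AE_I2 tendsto_mult F.diff_quot_tendsto P.diff_quot_tendsto) (use a b in auto)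
      show "AE x in lborel. norm (diff_quot \<Phi> e (a k) x * diff_quot \<Psi> d (b k) x)
          \<le> B * C * indicator (cball 0 (R + norm e)) x" for k
      proof (rule AE_I2)
        fix x :: 'a
        show "norm (diff_quot \<Phi> e (a k) x * diff_quot \<Psi> d (b k) x) \<le> B * C * indicator (cball 0 (R + norm e)) x"
        proof (cases "norm x \<le> R + norm e")
          case True
          then show ?thesis
            using F.diff_quot_bound[OF B(1) a(2)] P.diff_quot_bound[OF C(1) b(2)] B(2)
            by (simp add: abs_mult mult_mono)
        next
          case False
          have "norm (a k *\<^sub>R e) \<le> norm e" using a(3)[of k] by (simp add: mult_left_le_one_le)
          then have "norm (x + a k *\<^sub>R e) \<ge> R" "norm x \<ge> R"
            using norm_diff_ineq[of x "a k *\<^sub>R e"] False norm_ge_zero[of e] by linarith+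
          then have "diff_quot \<Phi> e (a k) x = 0" by (simp add: diff_quot_def F.supp)
          then show ?thesis using B C by simp
        qed
      qed
    qed (auto intro!: borel_measurable_continuous_onI F.cont P.cont F.cont_diff_quot P.cont_diff_quot continuous_on_mult)
  qed
  define a where "a = (\<lambda>k::nat. 1 / (real k + 1))"
  have a: "a \<longlonglongrightarrow> 0" "\<And>k. a k \<noteq> 0" "\<And>k. \<bar>a k\<bar> \<le> 1"
    unfolding a_def using LIMSEQ_inverse_real_of_nat by (auto simp: inverse_eq_divide add.commute)
  have ma: "(\<lambda>k. - a k) \<longlonglongrightarrow> 0" using tendsto_minus[OF a(1)] by simp
  have eq: "(\<integral>x. diff_quot \<Phi> e h x * diff_quot \<Psi> d h x \<partial>lborel) = (\<integral>x. diff_quot \<Phi> d (- h) x * diff_quot \<Psi> e (- h) x \<partial>lborel)"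
    if "h \<noteq> 0" for h
  proof -
    have int: "integrable lborel (\<lambda>x. \<Phi> (x + u) * \<Psi> (x + v))" for u v
    proof (rule integrable_compact_support[of _ "R + norm u"])
      show "continuous_on UNIV (\<lambda>x. \<Phi> (x + u) * \<Psi> (x + v))"
        by (intro continuous_on_mult continuous_on_compose2[OF F.cont_fun]
            continuous_on_compose2[OF P.cont_fun] continuous_intros) auto
      fix x :: 'a assume "norm x > R + norm u"
      then have "norm (x + u) \<ge> R" using norm_diff_ineq[of x u] by linarith
      then show "\<Phi> (x + u) * \<Psi> (x + v) = 0" by (simp add: F.supp)
    qed
    \<comment> \<open>By translation invariance \<open>J\<close> depends only on the difference of
      its arguments. Shifting by \<open>- (h *\<^sub>R e) - h *\<^sub>R d\<close> exchanges the two
      directions at the price of reversing the step, and the denominator \<open>h'\<^sup>2\<close>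
      does not see the sign.\<close>
    define J where "J = (\<lambda>u v. \<integral>x. \<Phi> (x + u) * \<Psi> (x + v) \<partial>lborel)"
    have J: "J (u + c) (v + c) = J u v" for u v c
    proof -
      have "(\<lambda>x. \<Phi> (x + u) * \<Psi> (x + v)) \<in> borel_measurable borel"
        using meas by (intro borel_measurable_times measurable_compose[OF _ meas(1)] measurable_compose[OF _ meas(2)]) auto
      from lborel_translate[OF this, of c] show ?thesis
        unfolding J_def by (simp add: algebra_simps)
    qed
    have exp: "(\<integral>x. diff_quot \<Phi> e' h' x * diff_quot \<Psi> d' h' x \<partial>lborel) =
        (J (h' *\<^sub>R e') (h' *\<^sub>R d') - J (h' *\<^sub>R e') 0 - J 0 (h' *\<^sub>R d') + J 0 0) / h'\<^sup>2" for e' d' h'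
    proof -
      have "(\<lambda>x. diff_quot \<Phi> e' h' x * diff_quot \<Psi> d' h' x) = (\<lambda>x.
         (\<Phi> (x + h' *\<^sub>R e') * \<Psi> (x + h' *\<^sub>R d') - \<Phi> (x + h' *\<^sub>R e') * \<Psi> (x + 0)
          - \<Phi> (x + 0) * \<Psi> (x + h' *\<^sub>R d') + \<Phi> (x + 0) * \<Psi> (x + 0)) / h'\<^sup>2)"
        by (rule ext) (simp add: diff_quot_def power2_eq_square algebra_simps add_divide_distrib diff_divide_distrib)
      then show ?thesis unfolding J_def by (simp only: integral_divide_zero Bochner_Integration.integral_add Bochner_Integration.integral_diff int Bochner_Integration.integrable_diff)
    qed
    have 1: "J (h *\<^sub>R e) (h *\<^sub>R d) = J (- h *\<^sub>R d) (- h *\<^sub>R e)"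
      using J[of "h *\<^sub>R e" "- (h *\<^sub>R e) - h *\<^sub>R d" "h *\<^sub>R d"] by (simp add: algebra_simps)
    have 2: "J (h *\<^sub>R e) 0 = J 0 (- h *\<^sub>R e)"
      using J[of "h *\<^sub>R e" "- (h *\<^sub>R e)" 0] by simp
    have 3: "J 0 (h *\<^sub>R d) = J (- h *\<^sub>R d) 0"
      using J[of 0 "- (h *\<^sub>R d)" "h *\<^sub>R d"] by simp
    show ?thesis unfolding exp 1 2 3 by simp
  qed
  have "(\<lambda>k. \<integral>x. diff_quot \<Phi> e (a k) x * diff_quot \<Psi> d (a k) x \<partial>lborel) \<longlonglongrightarrow> (\<integral>x. \<Phi>' x e * \<Psi>' x d \<partial>lborel)"
    by (rule conv) (use a in auto)
  moreover have "(\<lambda>k. \<integral>x. diff_quot \<Phi> d (- a k) x * diff_quot \<Psi> e (- a k) x \<partial>lborel) \<longlonglongrightarrow> (\<integral>x. \<Phi>' x d * \<Psi>' x e \<partial>lborel)"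
    by (rule conv) (use a ma in auto)
  ultimately show ?thesis
    using LIMSEQ_unique eq[OF a(2)] by simp
qed

section \<open>Dilations and radial integrals\<close>

lemma lborel_scale:
  fixes g :: "'a::euclidean_space \<Rightarrow> real"
  assumes "g \<in> borel_measurable borel" "c > 0"
  shows "(\<integral>x. c ^ DIM('a) * g (c *\<^sub>R x) \<partial>lborel) = (\<integral>x. g x \<partial>lborel)"
proof -
  have "(\<integral>x. g x \<partial>lborel)
      = (\<integral>x. g x \<partial>density (distr lborel borel (\<lambda>x::'a. 0 + c *\<^sub>R x)) (\<lambda>_. \<bar>c\<bar> ^ DIM('a)))"
    by (subst lborel_affine[of c 0]) (use assms in auto)
  also have "\<dots> = (\<integral>x. \<bar>c\<bar> ^ DIM('a) *\<^sub>R g x \<partial>distr lborel borel (\<lambda>x::'a. 0 + c *\<^sub>R x))"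
    using assms by (subst integral_density) auto
  also have "\<dots> = (\<integral>x. c ^ DIM('a) * g (c *\<^sub>R x) \<partial>lborel)"
    using assms by (subst integral_distr) auto
  finally show ?thesis by simp
qed

lemma cutoff_sq_scale_derivative:
  "((\<lambda>t. (cutoff (t *\<^sub>R x))\<^sup>2) has_real_derivative 2 * cutoff (t *\<^sub>R x) * cutoff' (t *\<^sub>R x) * (t * (x \<bullet> x))) (at t within S)"
proof -
  have "((\<lambda>t. cutoff (t *\<^sub>R x)) has_derivative (\<lambda>h. cutoff' (t *\<^sub>R x) * (t *\<^sub>R x \<bullet> (h *\<^sub>R x)))) (at t)"
    by (rule has_derivative_compose[OF _ has_derivative_cutoff]) (auto intro!: derivative_eq_intros)
  then have "((\<lambda>t. cutoff (t *\<^sub>R x)) has_real_derivative (cutoff' (t *\<^sub>R x) * (t * (x \<bullet> x)))) (at t)"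
    unfolding has_field_derivative_def by (simp add: mult_ac mult_commute_abs)
  from DERIV_power[OF this, of 2]
  have "((\<lambda>t. (cutoff (t *\<^sub>R x))\<^sup>2) has_real_derivative 2 * cutoff (t *\<^sub>R x) * cutoff' (t *\<^sub>R x) * (t * (x \<bullet> x))) (at t)"
    by (simp add: mult_ac)
  then show ?thesis by (rule has_field_derivative_at_within)
qed

text \<open>For \<open>c\<close> of degree \<open>-DIM('a)\<close> the integral of
  \<open>(cutoff (t *\<^sub>R x))\<^sup>2 * c x\<close> does not depend on \<open>t\<close>, and its
  derivative at \<open>t = 1\<close> is the integral in question. In polar coordinates this is the
  integral over r of the derivative of a compactly supported function.\<close>

lemma radial_integral_eq_0:
  fixes c :: "'a::euclidean_space \<Rightarrow> real"
  assumes cont: "continuous_on (- {0}) c"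
    and hom: "\<And>l x. l > 0 \<Longrightarrow> x \<noteq> 0 \<Longrightarrow> l ^ DIM('a) * c (l *\<^sub>R x) = c x"
  shows "(\<integral>x. 2 * cutoff x * cutoff' x * (x \<bullet> x) * c x \<partial>lborel) = 0"
proof -
  define a where "a = (\<lambda>k::nat. 1 / (real k + 1))"
  have a: "a \<longlonglongrightarrow> 0" "\<And>k. a k \<noteq> 0" "\<And>k. 0 < a k" "\<And>k. a k \<le> 1"
    unfolding a_def using LIMSEQ_inverse_real_of_nat by (auto simp: inverse_eq_divide add.commute)
  define g where "g = (\<lambda>t x. (cutoff (t *\<^sub>R x))\<^sup>2 * c x)"
  have gc: "continuous_on UNIV (g t)" if "1 \<le> t" "t \<le> 2" for t
  proof (rule continuous_on_zero_near_0[where r="1/2"])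
    show "continuous_on (- {0}) (g t)"
      unfolding g_def by (intro continuous_intros cont continuous_on_compose2[OF continuous_cutoff(1)[of UNIV]]) auto
    fix x :: 'a assume "norm x < 1/2"
    moreover have "t * norm x \<le> 2 * norm x" using that by (intro mult_right_mono) auto
    ultimately have "norm (t *\<^sub>R x) \<le> 1" using that by auto
    then show "g t x = 0" by (simp add: g_def cutoff_eq_0)
  qed auto
  have g0: "g t x = 0" if "norm x > 2" "1 \<le> t" for t x
  proof -
    have "1 * norm x \<le> t * norm x" using that by (intro mult_right_mono) auto
    then have "norm (t *\<^sub>R x) \<ge> 2" using that by auto
    then show ?thesis by (simp add: g_def cutoff_eq_0)
  qed
  have gi: "integrable lborel (g t)" if "1 \<le> t" "t \<le> 2" for t
    by (rule integrable_compact_support[OF gc, of _ 2]) (use g0 that in auto)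
  have inv: "(\<integral>x. g t x \<partial>lborel) = (\<integral>x. g 1 x \<partial>lborel)" if "1 \<le> t" "t \<le> 2" for t
  proof -
    have "(\<integral>x. g 1 x \<partial>lborel) = (\<integral>x. t ^ DIM('a) * g 1 (t *\<^sub>R x) \<partial>lborel)"
      by (rule lborel_scale[symmetric]) (use gc that in \<open>auto intro!: borel_measurable_continuous_onI\<close>)
    also have "(\<lambda>x. t ^ DIM('a) * g 1 (t *\<^sub>R x)) = g t"
    proof
      fix x :: 'a
      show "t ^ DIM('a) * g 1 (t *\<^sub>R x) = g t x"
      proof (cases "x = 0")
        case True then show ?thesis by (simp add: g_def cutoff_eq_0)
      next
        case False
        have "t ^ DIM('a) * g 1 (t *\<^sub>R x) = (cutoff (t *\<^sub>R x))\<^sup>2 * (t ^ DIM('a) * c (t *\<^sub>R x))"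
          by (simp add: g_def)
        then show ?thesis using hom[OF _ False, of t] that by (simp add: g_def)
      qed
    qed
    finally show ?thesis by simp
  qed
  obtain B where B: "\<And>x::'a. norm x \<le> 4 \<Longrightarrow> \<bar>2 * cutoff x * cutoff' x\<bar> \<le> B"
  proof -
    have "compact ((\<lambda>x::'a. 2 * cutoff x * cutoff' x) ` cball 0 4)"
      by (intro compact_continuous_image continuous_intros continuous_cutoff) auto
    then obtain B where "\<And>x::'a. x \<in> cball 0 4 \<Longrightarrow> norm (2 * cutoff x * cutoff' x) \<le> B"
      using compact_imp_bounded bounded_iff by (metis (no_types, lifting) image_eqI)
    then show ?thesis using that[of B] by auto
  qed
  \<comment> \<open>The inner radius is 1/2 because every dilate by at most 2 of a shorter vector
    lies in the unit ball, where the cutoff vanishes; the singularity of \<open>c\<close> is never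
    met.\<close>
  obtain C where C: "\<And>x. 1/2 \<le> norm x \<Longrightarrow> norm x \<le> 2 \<Longrightarrow> \<bar>c x\<bar> \<le> C"
  proof -
    have "compact (c ` (cball 0 2 - ball 0 (1/2)))"
      by (intro compact_continuous_image continuous_on_subset[OF cont] compact_diff) auto
    then obtain C where "\<And>x. x \<in> cball 0 2 - ball 0 (1/2) \<Longrightarrow> norm (c x) \<le> C"
      using compact_imp_bounded bounded_iff by (metis (no_types, lifting) image_eqI)
    then show ?thesis using that[of C] by auto
  qed
  have B0: "B \<ge> 0" using B[of 0] by auto
  define q where "q = (\<lambda>k x. (g (1 + a k) x - g 1 x) / a k)"
  have qz: "(\<integral>x. q k x \<partial>lborel) = 0" for k
    unfolding q_def using inv[of "1 + a k"] gi[of "1 + a k"] gi[of 1] a(3,4)[of k] by simp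
  \<comment> \<open>In the dominating function, \<open>8\<close> bounds
    \<open>t * (x \<bullet> x)\<close> for \<open>t \<le> 2\<close> and
    \<open>norm x \<le> 2\<close>. The dilated argument then has norm at most 4, whence the ball in
    the choice of \<open>B\<close>.\<close>
  have "(\<lambda>k. \<integral>x. q k x \<partial>lborel) \<longlonglongrightarrow> (\<integral>x. 2 * cutoff x * cutoff' x * (x \<bullet> x) * c x \<partial>lborel)"
  proof (rule integral_dominated_convergence[where w="\<lambda>x. B * 8 * C * indicator (cball 0 2) x"])
    show "integrable lborel (\<lambda>x::'a. B * 8 * C * indicator (cball 0 2) x)"
      by (intro integrable_mult_right integrable_indicator_cball)
    have "continuous_on UNIV (\<lambda>x. 2 * cutoff x * cutoff' x * (x \<bullet> x) * c x)"
      by (rule continuous_on_zero_near_0[where r=1])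
        (auto intro!: continuous_intros cont continuous_cutoff simp: cutoff_eq_0)
    then show "(\<lambda>x. 2 * cutoff x * cutoff' x * (x \<bullet> x) * c x) \<in> borel_measurable lborel"
      by (auto intro: borel_measurable_continuous_onI)
    show "q k \<in> borel_measurable lborel" for k
    proof -
      have "continuous_on UNIV (q k)"
        unfolding q_def divide_inverse using gc[of "1 + a k"] gc[of 1] a(3,4)[of k] by (intro continuous_intros) auto
      then show ?thesis by (auto intro: borel_measurable_continuous_onI)
    qed
    show "AE x in lborel. (\<lambda>k. q k x) \<longlonglongrightarrow> 2 * cutoff x * cutoff' x * (x \<bullet> x) * c x"
    proof (rule AE_I2)
      fix x :: 'a
      have "((\<lambda>h. ((cutoff ((1 + h) *\<^sub>R x))\<^sup>2 - (cutoff (1 *\<^sub>R x))\<^sup>2) / h) \<longlongrightarrow> 2 * cutoff (1 *\<^sub>R x) * cutoff' (1 *\<^sub>R x) * (1 * (x \<bullet> x))) (at 0)"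
        using cutoff_sq_scale_derivative[of x 1 UNIV] unfolding DERIV_def by simp
      moreover have "filterlim a (at 0) sequentially"
        using a by (simp add: filterlim_at)
      ultimately have "(\<lambda>k. ((cutoff ((1 + a k) *\<^sub>R x))\<^sup>2 - (cutoff (1 *\<^sub>R x))\<^sup>2) / a k) \<longlonglongrightarrow> 2 * cutoff x * cutoff' x * (x \<bullet> x)"
        using filterlim_compose by fastforce
      from tendsto_mult_right[OF this, of "c x"]
      show "(\<lambda>k. q k x) \<longlonglongrightarrow> 2 * cutoff x * cutoff' x * (x \<bullet> x) * c x"
        by (simp add: q_def g_def left_diff_distrib)
    qed
    show "AE x in lborel. norm (q k x) \<le> B * 8 * C * indicator (cball 0 2) x" for k
    proof (rule AE_I2)
      fix x :: 'a
      show "norm (q k x) \<le> B * 8 * C * indicator (cball 0 2) x"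
      proof (cases "norm x > 2")
        case True
        then show ?thesis using g0[OF True, of 1] g0[OF True, of "1 + a k"] a(3)[of k]
          by (simp add: q_def)
      next
        case False
        have C0: "C \<ge> 0"
        proof -
          obtain b :: 'a where "b \<in> Basis" using nonempty_Basis by blast
          then show ?thesis using C[of b] by force
        qed
        show ?thesis
        proof (cases "norm x < 1/2")
          case True
          have "(1 + a k) * norm x \<le> 2 * norm x" using a(4)[of k] by (intro mult_right_mono) auto
          then have "norm ((1 + a k) *\<^sub>R x) \<le> 1" "norm x \<le> 1" using True a(3)[of k] by auto
          then have "q k x = 0" by (simp add: q_def g_def cutoff_eq_0)
          then show ?thesis using B0 C0 by simp
        next
          case F2: False
          have "norm ((cutoff ((1 + a k) *\<^sub>R x))\<^sup>2 - (cutoff (1 *\<^sub>R x))\<^sup>2) \<le> (B * 8) * norm ((1 + a k) - 1)"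
          proof (rule field_differentiable_bound[OF _ cutoff_sq_scale_derivative, of "{1..2}"])
            fix t :: real assume t: "t \<in> {1..2}"
            have "t * norm x \<le> 2 * 2" using t False by (intro mult_mono) auto
            then have "\<bar>2 * cutoff (t *\<^sub>R x) * cutoff' (t *\<^sub>R x)\<bar> \<le> B" using t by (intro B) auto
            moreover have "t * (x \<bullet> x) \<le> 2 * (2 * 2)"
              unfolding dot_square_norm power2_eq_square using t False by (intro mult_mono) auto
            ultimately have "\<bar>2 * cutoff (t *\<^sub>R x) * cutoff' (t *\<^sub>R x)\<bar> * \<bar>t * (x \<bullet> x)\<bar> \<le> B * 8"
              using t B0 by (intro mult_mono) auto
            then show "norm (2 * cutoff (t *\<^sub>R x) * cutoff' (t *\<^sub>R x) * (t * (x \<bullet> x))) \<le> B * 8"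
              by (simp add: abs_mult)
          qed (use a(3,4)[of k] in auto)
          then have 1: "\<bar>((cutoff ((1 + a k) *\<^sub>R x))\<^sup>2 - (cutoff (1 *\<^sub>R x))\<^sup>2) / a k\<bar> \<le> B * 8"
            using a(3)[of k] by (simp add: field_simps)
          have 2: "\<bar>c x\<bar> \<le> C" using F2 False by (intro C) auto
          have "q k x = ((cutoff ((1 + a k) *\<^sub>R x))\<^sup>2 - (cutoff (1 *\<^sub>R x))\<^sup>2) / a k * c x"
            by (simp add: q_def g_def left_diff_distrib)
          then have "\<bar>q k x\<bar> \<le> (B * 8) * C"
            unfolding abs_mult using mult_mono[OF 1 2] B0 by (simp add: abs_mult)
          then show ?thesis using False by simp
        qed
      qed
    qed
  qed
  then show ?thesis using qz LIMSEQ_unique[OF _ tendsto_const] by simp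
qed

text \<open>
  The functional \<open>sphere_int\<close> integrates a function of degree \<open>-DIM('a)\<close> over the unit sphere, up to
  a constant factor.
\<close>

definition sphere_int :: "('a::euclidean_space \<Rightarrow> real) \<Rightarrow> real" where
  "sphere_int a = (\<integral>x. (cutoff x)\<^sup>2 * a x \<partial>lborel)"

lemma sphere_int_integrable:
  fixes a :: "'a::euclidean_space \<Rightarrow> real"
  assumes "continuous_on (- {0}) a"
  shows "continuous_on UNIV (\<lambda>x. (cutoff x)\<^sup>2 * a x)" "integrable lborel (\<lambda>x. (cutoff x)\<^sup>2 * a x)"
proof -
  show *: "continuous_on UNIV (\<lambda>x. (cutoff x)\<^sup>2 * a x)"
    by (rule continuous_on_zero_near_0[where r=1])
      (auto intro!: continuous_intros assms continuous_cutoff simp: cutoff_eq_0)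
  show "integrable lborel (\<lambda>x. (cutoff x)\<^sup>2 * a x)"
    by (rule integrable_compact_support[OF *, of 2]) (simp add: cutoff_eq_0)
qed

lemma sphere_int_cong:
  assumes "\<And>x. x \<noteq> 0 \<Longrightarrow> a x = b x"
  shows "sphere_int a = sphere_int b"
proof -
  have "(cutoff x)\<^sup>2 * a x = (cutoff x)\<^sup>2 * b x" for x
    using assms[of x] by (cases "x = 0") (auto simp: cutoff_eq_0)
  then show ?thesis unfolding sphere_int_def by (simp only:)
qed

lemma sphere_int_add:
  assumes "continuous_on (- {0}) a" "continuous_on (- {0}) b"
  shows "sphere_int (\<lambda>x. a x + b x) = sphere_int a + sphere_int b"
  unfolding sphere_int_def distrib_left by (intro Bochner_Integration.integral_add sphere_int_integrable assms)

lemma sphere_int_diff: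
  assumes "continuous_on (- {0}) a" "continuous_on (- {0}) b"
  shows "sphere_int (\<lambda>x. a x - b x) = sphere_int a - sphere_int b"
  unfolding sphere_int_def right_diff_distrib by (intro Bochner_Integration.integral_diff sphere_int_integrable assms)

lemma sphere_int_cmult: "sphere_int (\<lambda>x. c * a x) = c * sphere_int a"
  unfolding sphere_int_def by (simp add: mult.left_commute)

lemma sphere_int_sum:
  assumes "\<And>i. i \<in> I \<Longrightarrow> continuous_on (- {0}) (a i)"
  shows "sphere_int (\<lambda>x. \<Sum>i\<in>I. a i x) = (\<Sum>i\<in>I. sphere_int (a i))"
  unfolding sphere_int_def sum_distrib_left by (intro Bochner_Integration.integral_sum sphere_int_integrable assms)

text \<open>The set where the integrand is nonzero is open and a null set, hence empty. Only the
  annulus where the cutoff is positive is seen; homogeneity has to carry the conclusion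
  elsewhere.\<close>

lemma sphere_int_eq_0_imp:
  fixes a :: "'a::euclidean_space \<Rightarrow> real"
  assumes cont: "continuous_on (- {0}) a" and nn: "\<And>x. x \<noteq> 0 \<Longrightarrow> a x \<ge> 0"
    and zero: "sphere_int a = 0" and x: "1 < norm x" "norm x < 2"
  shows "a x = 0"
proof -
  define g where "g = (\<lambda>x. (cutoff x)\<^sup>2 * a x)"
  have gc: "continuous_on UNIV g" and gi: "integrable lborel g"
    unfolding g_def using sphere_int_integrable[OF cont] by auto
  have gn: "g x \<ge> 0" for x
    using nn[of x] by (cases "x = 0") (auto simp: cutoff_eq_0 g_def)
  have "AE x in lborel. g x = 0"
    using integral_nonneg_eq_0_iff_AE[OF gi] gn zero unfolding sphere_int_def g_def by simp
  moreover have op: "open {x. g x \<noteq> 0}"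
    using open_Collect_neq[OF gc continuous_on_const[of UNIV 0]] by simp
  ultimately have "{x. g x \<noteq> 0} \<in> null_sets lborel"
    by (subst AE_iff_null_sets) (auto elim: eventually_mono)
  then have "negligible {x. g x \<noteq> 0}"
    by (simp add: negligible_iff_null_sets null_sets_completionI)
  then have "{x. g x \<noteq> 0} = {}"
    using open_not_negligible[OF op] by blast
  then have "g x = 0" by auto
  then show ?thesis using cutoff_pos[OF x] by (simp add: g_def)
qed

text \<open>The weight \<open>z\<close> is kept general since two are used: the squared cutoff for a
  single function, and the cutoff itself on each factor of a product.\<close>

lemma cutoff_C1_compact:
  fixes \<phi> :: "'a::euclidean_space \<Rightarrow> real"
  assumes \<phi>: "C1_off0 \<phi> \<phi>'"
    and z: "\<And>x. (z has_derivative (\<lambda>v. z' x * (x \<bullet> v))) (at x)"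
      "continuous_on UNIV z" "continuous_on UNIV z'"
    and z0: "\<And>x. norm x \<le> 1 \<or> norm x \<ge> 2 \<Longrightarrow> z x = 0" "\<And>x. norm x \<le> 1 \<or> norm x \<ge> 2 \<Longrightarrow> z' x = 0"
  shows "C1_compact (\<lambda>x. z x * \<phi> x) (\<lambda>x v. z x * \<phi>' x v + z' x * (x \<bullet> v) * \<phi> x) 2"
proof
  show "continuous_on UNIV (\<lambda>x. z x * \<phi>' x v + z' x * (x \<bullet> v) * \<phi> x)" for v
    by (rule continuous_on_zero_near_0[where r=1])
      (use \<phi> z0 in \<open>auto intro!: continuous_intros C1_off0_continuous[OF \<phi>] continuous_on_subset[OF z(2)]
       continuous_on_subset[OF z(3)] simp: C1_off0_def\<close>)
  show "((\<lambda>x. z x * \<phi> x) has_derivative (\<lambda>v. z x * \<phi>' x v + z' x * (x \<bullet> v) * \<phi> x)) (at x)" for x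
  proof (cases "x = 0")
    case False
    then have "(\<phi> has_derivative \<phi>' x) (at x)" using \<phi> by (simp add: C1_off0_def)
    from has_derivative_mult[OF z(1) this] show ?thesis by (simp add: mult.commute)
  next
    case True
    have "((\<lambda>x. z x * \<phi> x) has_derivative (\<lambda>v. 0)) (at x)"
      by (rule has_derivative_transform_within_open[where f="\<lambda>_. 0" and s="ball 0 1"]) (use True z0 in auto)
    then show ?thesis using True z0 by simp
  qed
qed (use z0 in auto)

lemma has_derivative_cutoff_sq:
  "((\<lambda>x. (cutoff x)\<^sup>2) has_derivative (\<lambda>v. 2 * cutoff x * cutoff' x * (x \<bullet> v))) (at x)"
  by (auto intro!: derivative_eq_intros has_derivative_cutoff)

text \<open>The partial derivative of the product with the squared cutoff has integral zero. The
  term with the derivative on the weight equals the radial integrand for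
  \<open>(x \<bullet> e) / (x \<bullet> x) * \<phi> x\<close>, a function of degree
  \<open>-DIM('a)\<close>, and drops out.\<close>

lemma sphere_int_partial:
  fixes \<phi> :: "'a::euclidean_space \<Rightarrow> real"
  assumes \<phi>: "C1_off0 \<phi> \<phi>'"
    and hom: "\<And>l x. l > 0 \<Longrightarrow> x \<noteq> 0 \<Longrightarrow> l ^ (DIM('a) - 1) * \<phi> (l *\<^sub>R x) = \<phi> x"
  shows "sphere_int (\<lambda>x. \<phi>' x e) = 0"
proof -
  interpret C1_compact "\<lambda>x. (cutoff x)\<^sup>2 * \<phi> x" "\<lambda>x v. (cutoff x)\<^sup>2 * \<phi>' x v + 2 * cutoff x * cutoff' x * (x \<bullet> v) * \<phi> x" 2
    by (rule cutoff_C1_compact[where z="\<lambda>x. (cutoff x)\<^sup>2" and z'="\<lambda>x. 2 * cutoff x * cutoff' x", OF \<phi> has_derivative_cutoff_sq])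
      (auto intro!: continuous_intros continuous_cutoff simp: cutoff_eq_0)
  define c where "c = (\<lambda>x. (x \<bullet> e) / (x \<bullet> x) * \<phi> x)"
  have cc: "continuous_on (- {0}) c"
    unfolding c_def by (intro continuous_intros C1_off0_continuous[OF \<phi>]) auto
  have ch: "l ^ DIM('a) * c (l *\<^sub>R x) = c x" if "l > 0" "x \<noteq> 0" for l x
  proof -
    have "l ^ DIM('a) = l ^ (DIM('a) - 1) * l"
      using DIM_positive[where 'a='a] by (metis Suc_diff_1 power_Suc2)
    then have "l ^ DIM('a) * c (l *\<^sub>R x) = (x \<bullet> e) / (x \<bullet> x) * (l ^ (DIM('a) - 1) * \<phi> (l *\<^sub>R x))"
      using that by (simp add: c_def field_simps)
    then show ?thesis using hom[OF that] by (simp add: c_def)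
  qed
  have rad: "(\<integral>x. 2 * cutoff x * cutoff' x * (x \<bullet> x) * c x \<partial>lborel) = 0"
    by (rule radial_integral_eq_0[OF cc]) (rule ch)
  have eq: "(cutoff x)\<^sup>2 * \<phi>' x e + 2 * cutoff x * cutoff' x * (x \<bullet> e) * \<phi> x
      = (cutoff x)\<^sup>2 * \<phi>' x e + 2 * cutoff x * cutoff' x * (x \<bullet> x) * c x" for x
    by (cases "x = 0") (auto simp: c_def)
  have "integrable lborel (\<lambda>x. 2 * cutoff x * cutoff' x * (x \<bullet> x) * c x)"
  proof (rule integrable_compact_support[where R=2])
    show "continuous_on UNIV (\<lambda>x. 2 * cutoff x * cutoff' x * (x \<bullet> x) * c x)"
      by (rule continuous_on_zero_near_0[where r=1])
        (auto intro!: continuous_intros cc continuous_cutoff simp: cutoff_eq_0)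
  qed (simp add: cutoff_eq_0)
  moreover have "integrable lborel (\<lambda>x. (cutoff x)\<^sup>2 * \<phi>' x e)"
    using \<phi> by (intro sphere_int_integrable) (simp add: C1_off0_def)
  ultimately have "(\<integral>x. (cutoff x)\<^sup>2 * \<phi>' x e + 2 * cutoff x * cutoff' x * (x \<bullet> x) * c x \<partial>lborel)
      = sphere_int (\<lambda>x. \<phi>' x e) + (\<integral>x. 2 * cutoff x * cutoff' x * (x \<bullet> x) * c x \<partial>lborel)"
    unfolding sphere_int_def by (intro Bochner_Integration.integral_add)
  then show ?thesis
    using integral_partial_eq_0[of e] rad by (simp add: eq)
qed

text \<open>Each factor carries one cutoff, so that their product carries the square used in
  \<open>sphere_int\<close>; the exchange of directions for compactly supported functions then
  applies, up to terms with \<open>cutoff'\<close>.\<close>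

lemma sphere_int_swap:
  fixes \<phi> \<psi> :: "'a::euclidean_space \<Rightarrow> real"
  assumes dim: "DIM('a) \<ge> 2" and \<phi>: "C1_off0 \<phi> \<phi>'" and \<psi>: "C1_off0 \<psi> \<psi>'"
    and hom_\<phi>: "\<And>l x. l > 0 \<Longrightarrow> x \<noteq> 0 \<Longrightarrow> l ^ (DIM('a) - 2) * \<phi> (l *\<^sub>R x) = \<phi> x"
    and hom_\<psi>: "\<And>l x. l > 0 \<Longrightarrow> x \<noteq> 0 \<Longrightarrow> \<psi> (l *\<^sub>R x) = \<psi> x"
  shows "sphere_int (\<lambda>x. \<phi>' x e * \<psi>' x d) = sphere_int (\<lambda>x. \<phi>' x d * \<psi>' x e)"
proof -
  note c1 = cutoff_C1_compact[where z=cutoff and z'=cutoff', OF _ has_derivative_cutoff continuous_cutoff cutoff_eq_0]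
  have swap: "(\<integral>x. (cutoff x * \<phi>' x e + cutoff' x * (x \<bullet> e) * \<phi> x) * (cutoff x * \<psi>' x d + cutoff' x * (x \<bullet> d) * \<psi> x) \<partial>lborel)
    = (\<integral>x. (cutoff x * \<phi>' x d + cutoff' x * (x \<bullet> d) * \<phi> x) * (cutoff x * \<psi>' x e + cutoff' x * (x \<bullet> e) * \<psi> x) \<partial>lborel)"
    using integral_partials_swap[OF c1[OF \<phi>] c1[OF \<psi>]] by simp
  \<comment> \<open>Under antisymmetrization in \<open>e\<close> and \<open>d\<close> the terms
    quadratic in \<open>cutoff'\<close> cancel. The linear ones combine to the radial integrand for
    \<open>c\<close>, and the degrees of \<open>\<phi>\<close> and \<open>\<psi>\<close> give
    \<open>c\<close> degree \<open>-DIM('a)\<close>.\<close>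
  define b where "b = (\<lambda>d x. \<phi> x * \<psi>' x d - \<phi>' x d * \<psi> x)"
  define c where "c = (\<lambda>x. ((x \<bullet> e) * b d x - (x \<bullet> d) * b e x) / (2 * (x \<bullet> x)))"
  have ders: "continuous_on (- {0}) (\<lambda>x. \<phi>' x v)" "continuous_on (- {0}) (\<lambda>x. \<psi>' x v)" for v
    using \<phi> \<psi> by (auto simp: C1_off0_def)
  have bc: "continuous_on (- {0}) (b v)" for v
    unfolding b_def by (intro continuous_intros ders C1_off0_continuous[OF \<phi>] C1_off0_continuous[OF \<psi>])
  have cc: "continuous_on (- {0}) c"
    unfolding c_def by (intro continuous_intros bc) auto
  have bh: "l ^ (DIM('a) - 1) * b v (l *\<^sub>R x) = b v x" if "l > 0" "x \<noteq> 0" for l x v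
  proof -
    have "DIM('a) - 1 = Suc (DIM('a) - 2)" using dim by linarith
    then have p: "l ^ (DIM('a) - 1) = l ^ (DIM('a) - 2) * l" by simp
    have 1: "(l ^ (DIM('a) - 2) * l) *\<^sub>R \<phi>' (l *\<^sub>R x) v = \<phi>' x v"
      by (rule derivative_homogeneous[OF \<phi> that]) (use hom_\<phi>[OF that(1)] in auto)
    have 2: "(1 * l) *\<^sub>R \<psi>' (l *\<^sub>R x) v = \<psi>' x v"
      by (rule derivative_homogeneous[OF \<psi> that]) (use hom_\<psi>[OF that(1)] in auto)
    have "l ^ (DIM('a) - 1) * b v (l *\<^sub>R x) = (l ^ (DIM('a) - 2) * \<phi> (l *\<^sub>R x)) * (l * \<psi>' (l *\<^sub>R x) v)
       - ((l ^ (DIM('a) - 2) * l) * \<phi>' (l *\<^sub>R x) v) * \<psi> (l *\<^sub>R x)"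
      unfolding p b_def by (simp add: algebra_simps)
    then show ?thesis using 1 2 hom_\<phi>[OF that] hom_\<psi>[OF that] by (simp add: b_def)
  qed
  have ch: "l ^ DIM('a) * c (l *\<^sub>R x) = c x" if "l > 0" "x \<noteq> 0" for l x
  proof -
    have "l ^ DIM('a) = l ^ (DIM('a) - 1) * l"
      using DIM_positive[where 'a='a] by (metis Suc_diff_1 power_Suc2)
    then have "l ^ DIM('a) * c (l *\<^sub>R x) = ((x \<bullet> e) * (l ^ (DIM('a) - 1) * b d (l *\<^sub>R x))
       - (x \<bullet> d) * (l ^ (DIM('a) - 1) * b e (l *\<^sub>R x))) / (2 * (x \<bullet> x))"
      using that by (simp add: c_def field_simps)
    then show ?thesis using bh[OF that] by (simp add: c_def)
  qed
  have rad: "(\<integral>x. 2 * cutoff x * cutoff' x * (x \<bullet> x) * c x \<partial>lborel) = 0"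
    by (rule radial_integral_eq_0[OF cc]) (rule ch)
  have int1: "integrable lborel (\<lambda>x. 2 * cutoff x * cutoff' x * (x \<bullet> x) * c x)"
  proof (rule integrable_compact_support[where R=2])
    show "continuous_on UNIV (\<lambda>x. 2 * cutoff x * cutoff' x * (x \<bullet> x) * c x)"
      by (rule continuous_on_zero_near_0[where r=1])
        (auto intro!: continuous_intros cc continuous_cutoff simp: cutoff_eq_0)
  qed (simp add: cutoff_eq_0)
  have int2: "integrable lborel (\<lambda>x. (cutoff x * \<phi>' x e + cutoff' x * (x \<bullet> e) * \<phi> x) * (cutoff x * \<psi>' x d + cutoff' x * (x \<bullet> d) * \<psi> x))" for e d
  proof (rule integrable_compact_support[where R=2])
    show "continuous_on UNIV (\<lambda>x. (cutoff x * \<phi>' x e + cutoff' x * (x \<bullet> e) * \<phi> x) * (cutoff x * \<psi>' x d + cutoff' x * (x \<bullet> d) * \<psi> x))"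
      by (rule continuous_on_zero_near_0[where r=1])
        (auto intro!: continuous_intros ders C1_off0_continuous[OF \<phi>] C1_off0_continuous[OF \<psi>] continuous_cutoff simp: cutoff_eq_0)
  qed (simp add: cutoff_eq_0)
  have eq: "(cutoff x)\<^sup>2 * (\<phi>' x e * \<psi>' x d - \<phi>' x d * \<psi>' x e) =
      (cutoff x * \<phi>' x e + cutoff' x * (x \<bullet> e) * \<phi> x) * (cutoff x * \<psi>' x d + cutoff' x * (x \<bullet> d) * \<psi> x)
      - (cutoff x * \<phi>' x d + cutoff' x * (x \<bullet> d) * \<phi> x) * (cutoff x * \<psi>' x e + cutoff' x * (x \<bullet> e) * \<psi> x)
      - 2 * cutoff x * cutoff' x * (x \<bullet> x) * c x" for x
  proof (cases "x = 0")
    case False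
    then have "2 * (x \<bullet> x) * c x = (x \<bullet> e) * b d x - (x \<bullet> d) * b e x" by (simp add: c_def)
    have "2 * cutoff x * cutoff' x * (x \<bullet> x) * c x = cutoff x * cutoff' x * (2 * (x \<bullet> x) * c x)"
      by (simp add: mult_ac)
    also have "\<dots> = cutoff x * cutoff' x * ((x \<bullet> e) * b d x - (x \<bullet> d) * b e x)"
      by (simp only: \<open>2 * (x \<bullet> x) * c x = _\<close>)
    finally show ?thesis by (simp only:) (simp add: b_def algebra_simps power2_eq_square)
  qed (simp add: cutoff_eq_0)
  have "sphere_int (\<lambda>x. \<phi>' x e * \<psi>' x d - \<phi>' x d * \<psi>' x e) = 0"
    unfolding sphere_int_def eq
    using int1 int2[of e d] int2[of d e] swap rad by simp
  then show ?thesis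
    by (subst (asm) sphere_int_diff) (auto intro!: continuous_intros ders)
qed

lemma sphere_int_divergence:
  fixes X :: "'a::euclidean_space \<Rightarrow> 'a"
  assumes X: "C1_off0 X X'"
    and hom: "\<And>l x. l > 0 \<Longrightarrow> x \<noteq> 0 \<Longrightarrow> l ^ (DIM('a) - 1) *\<^sub>R X (l *\<^sub>R x) = X x"
  shows "sphere_int (\<lambda>x. ltrace (X' x)) = 0"
proof -
  have "sphere_int (\<lambda>x. ltrace (X' x)) = (\<Sum>b\<in>Basis. sphere_int (\<lambda>x. X' x b \<bullet> b))"
    unfolding ltrace_def using X by (intro sphere_int_sum continuous_intros) (auto simp: C1_off0_def)
  also have "\<dots> = 0"
  proof (rule sum.neutral, rule ballI)
    fix b :: 'a assume "b \<in> Basis"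
    show "sphere_int (\<lambda>x. X' x b \<bullet> b) = 0"
    proof (rule sphere_int_partial[OF C1_off0_inner_const[OF X]])
      show "l ^ (DIM('a) - 1) * (X (l *\<^sub>R x) \<bullet> b) = X x \<bullet> b" if "l > 0" "x \<noteq> 0" for l x
        unfolding hom[OF that, symmetric] by simp
    qed
  qed
  finally show ?thesis .
qed

text \<open>For smooth fields the difference of the two integrands is the divergence of DX Y - (div
  X) Y. For fields of class C^1 the derivative directions are exchanged separately in each pair of
  components.\<close>

lemma sphere_int_trace_product:
  fixes X Y :: "'a::euclidean_space \<Rightarrow> 'a"
  assumes dim: "DIM('a) \<ge> 2" and X: "C1_off0 X X'" and Y: "C1_off0 Y Y'"
    and hom_X: "\<And>l x. l > 0 \<Longrightarrow> x \<noteq> 0 \<Longrightarrow> l ^ (DIM('a) - 2) *\<^sub>R X (l *\<^sub>R x) = X x"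
    and hom_Y: "\<And>l x. l > 0 \<Longrightarrow> x \<noteq> 0 \<Longrightarrow> Y (l *\<^sub>R x) = Y x"
  shows "sphere_int (\<lambda>x. ltrace (\<lambda>v. X' x (Y' x v))) = sphere_int (\<lambda>x. ltrace (X' x) * ltrace (Y' x))"
proof -
  have c: "continuous_on (- {0}) (\<lambda>x. X' x v)" "continuous_on (- {0}) (\<lambda>x. Y' x v)" for v
    using X Y by (auto simp: C1_off0_def)
  have "sphere_int (\<lambda>x. ltrace (\<lambda>v. X' x (Y' x v))) = sphere_int (\<lambda>x. \<Sum>b\<in>Basis. \<Sum>c\<in>Basis. (X' x c \<bullet> b) * (Y' x b \<bullet> c))"
    unfolding ltrace_def
    by (intro sphere_int_cong sum.cong refl) (subst inner_compose_expand[OF C1_off0_linear[OF X]], auto simp: mult.commute)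
  also have "\<dots> = (\<Sum>b\<in>Basis. \<Sum>c\<in>Basis. sphere_int (\<lambda>x. (X' x c \<bullet> b) * (Y' x b \<bullet> c)))"
    by (subst sphere_int_sum, (intro continuous_intros c)[1], intro sum.cong refl sphere_int_sum continuous_intros c)
  also have "\<dots> = (\<Sum>b\<in>Basis. \<Sum>c\<in>Basis. sphere_int (\<lambda>x. (X' x b \<bullet> b) * (Y' x c \<bullet> c)))"
  proof (intro sum.cong refl)
    fix b c :: 'a
    show "sphere_int (\<lambda>x. (X' x c \<bullet> b) * (Y' x b \<bullet> c)) = sphere_int (\<lambda>x. (X' x b \<bullet> b) * (Y' x c \<bullet> c))"
    proof (rule sphere_int_swap[OF dim C1_off0_inner_const[OF X] C1_off0_inner_const[OF Y]])
      show "l ^ (DIM('a) - 2) * (X (l *\<^sub>R x) \<bullet> b) = X x \<bullet> b" if "l > 0" "x \<noteq> 0" for l x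
        unfolding hom_X[OF that, symmetric] by simp
      show "Y (l *\<^sub>R x) \<bullet> c = Y x \<bullet> c" if "l > 0" "x \<noteq> 0" for l x
        unfolding hom_Y[OF that] ..
    qed
  qed
  also have "\<dots> = sphere_int (\<lambda>x. \<Sum>b\<in>Basis. \<Sum>c\<in>Basis. (X' x b \<bullet> b) * (Y' x c \<bullet> c))"
    by (subst sphere_int_sum, (intro continuous_intros c)[1], intro sum.cong refl sphere_int_sum[symmetric] continuous_intros c)
  also have "\<dots> = sphere_int (\<lambda>x. ltrace (X' x) * ltrace (Y' x))"
    by (simp add: ltrace_def sum_product)
  finally show ?thesis .
qed

lemma sphere_int_eq_0_cong:
  assumes "sphere_int a = 0" "\<And>x. x \<noteq> 0 \<Longrightarrow> a x = b x"
  shows "sphere_int b = 0"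
  using assms(1) sphere_int_cong[of a b] assms(2) by simp

section \<open>Homogeneous solutions of degree one\<close>

text \<open>Mediates between the real exponents of \<open>f\<close> and the natural powers of the
  dilation factor in the homogeneity hypotheses.\<close>

lemma powr_scale_cancel:
  fixes f l :: real
  assumes "l > 0" "f > 0" "s = - real j"
  shows "l ^ j * (l * f) powr s = f powr s"
  using assms by (simp add: powr_mult powr_minus powr_realpow field_simps)

lemma homogeneous_gradient_norm:
  fixes f :: "'a::euclidean_space \<Rightarrow> real" and G :: "'a \<Rightarrow> 'a" and S :: "'a \<Rightarrow> 'a \<Rightarrow> 'a"
    and p m k :: real
  defines "n \<equiv> real DIM('a) - 1"
  assumes dim: "DIM('a) \<ge> 3"
    and f: "C1_off0 f (\<lambda>x v. G x \<bullet> v)" and G: "C1_off0 G S"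
    and pos: "\<And>x. x \<noteq> 0 \<Longrightarrow> f x > 0"
    and hom: "\<And>l x. l > 0 \<Longrightarrow> x \<noteq> 0 \<Longrightarrow> f (l *\<^sub>R x) = l * f x"
    and p: "p > 1" and m: "m < n" "n * (p - 1) / p < m"
    and eq: "\<And>x. x \<noteq> 0 \<Longrightarrow> ltrace (\<lambda>v. norm (G x) powr (p - 2) *\<^sub>R S x v
        + ((p - 2) * norm (G x) powr (p - 2 - 1) * ((G x \<bullet> S x v) / norm (G x))) *\<^sub>R G x)
      = (m * norm (G x) powr p + k) / f x"
    and x: "x \<noteq> 0"
  shows "norm (G x) powr p = k / (n - m)"
proof -
  have n2: "n \<ge> 2" using dim unfolding n_def by linarith
  have G_hom: "G (l *\<^sub>R x) = G x" if "l > 0" "x \<noteq> 0" for l x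
    by (rule gradient_homogeneous_1[OF f _ that]) (rule hom)
  have Gx: "G x \<bullet> x = f x" if "x \<noteq> 0" for x
    by (rule euler_homogeneous_1[OF f _ that]) (rule hom)
  have Sx: "S x x = 0" if "x \<noteq> 0" for x
    by (rule euler_homogeneous_0[OF G _ that]) (rule G_hom)
  have linS: "linear (S x)" if "x \<noteq> 0" for x using C1_off0_linear[OF G that] .
  have symS: "S x u \<bullet> v = u \<bullet> S x v" if "x \<noteq> 0" for x u v
  proof (rule second_derivative_symmetric)
    show "norm x > 0" using that by simp
    show "(f has_derivative (\<lambda>v. G y \<bullet> v)) (at y)" if "y \<in> ball x (norm x)" for y
      using that by (intro C1_off0_derivative[OF f]) auto
    show "(G has_derivative S x) (at x)" by (rule C1_off0_derivative[OF G that])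
  qed
  have Gnz: "G x \<noteq> 0" if "x \<noteq> 0" for x using Gx[OF that] pos[OF that] by auto

  define w where "w = (\<lambda>x. norm (G x))"
  define w' where "w' = (\<lambda>x v. (G x \<bullet> S x v) / w x)"
  have w: "C1_off0 w w'" unfolding w_def w'_def by (rule C1_off0_norm[OF G Gnz])
  have wpos: "w x > 0" if "x \<noteq> 0" for x using Gnz[OF that] by (simp add: w_def)
  have w_hom: "w (l *\<^sub>R x) = w x" if "l > 0" "x \<noteq> 0" for l x using G_hom[OF that] by (simp add: w_def)

  define F where "F = (\<lambda>x. w x powr p)"
  define F' where "F' = (\<lambda>x v. p * w x powr (p - 1) * w' x v)"
  have F: "C1_off0 F F'" unfolding F_def F'_def by (rule C1_off0_powr[OF w wpos])

  define H where "H = (\<lambda>x. w x powr (p - 2) *\<^sub>R G x)"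
  define H' where "H' = (\<lambda>x v. w x powr (p - 2) *\<^sub>R S x v + ((p - 2) * w x powr (p - 2 - 1) * w' x v) *\<^sub>R G x)"
  have H: "C1_off0 H H'"
    unfolding H_def H'_def w'_def w_def by (rule C1_off0_norm_powr_scaleR[OF G Gnz])
  have H_hom: "H (l *\<^sub>R x) = H x" if "l > 0" "x \<noteq> 0" for l x
    using G_hom[OF that] by (simp add: H_def w_def)
  have linH: "linear (H' x)" if "x \<noteq> 0" for x using C1_off0_linear[OF H that] .
  have H'_alt: "H' x v = w x powr (p - 2) *\<^sub>R S x v + ((p - 2) * w x powr (p - 4) * (G x \<bullet> S x v)) *\<^sub>R G x"
    if "x \<noteq> 0" for x v
  proof -
    have "w x powr (p - 2 - 1) = w x powr (p - 4) * w x powr 1"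
      unfolding powr_add[symmetric] by (simp add: algebra_simps)
    then show ?thesis using wpos[OF that] by (simp add: H'_def w'_def)
  qed
  define g where "g = (\<lambda>x. ltrace (H' x))"
  have g_eq: "f x * g x = m * F x + k" if "x \<noteq> 0" for x
  proof -
    show ?thesis using eq[OF that] pos[OF that]
      by (simp add: g_def w_def F_def H'_def w'_def del: diff_diff_eq)
  qed
  have GH: "G x \<bullet> H x = F x" if "x \<noteq> 0" for x
  proof -
    have "G x \<bullet> H x = w x powr (p - 2) * (w x)\<^sup>2"
      by (simp add: H_def w_def dot_square_norm)
    also have "(w x)\<^sup>2 = w x powr 2" using wpos[OF that] by simp
    finally show ?thesis unfolding F_def powr_add[symmetric] by simp
  qed
  \<comment> \<open>Paired with \<open>G\<close>, the radial stretching by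
    \<open>|G| powr (p - 2)\<close> gives the factor \<open>p - 1\<close> on
    \<open>G x \<bullet> S x v\<close>, whereas \<open>F'\<close> has the factor \<open>p\<close>.
    This is the origin of the constant \<open>(p - 1) / p\<close>.\<close>
  have GH': "G x \<bullet> H' x v = (p - 1) / p * F' x v" if "x \<noteq> 0" for x v
  proof -
    have 1: "w x powr (p - 4) * (w x)\<^sup>2 = w x powr (p - 2)"
    proof -
      have "(w x)\<^sup>2 = w x powr 2" using wpos[OF that] by simp
      then have "w x powr (p - 4) * (w x)\<^sup>2 = w x powr (p - 4 + 2)" by (simp only: powr_add)
      then show ?thesis by simp
    qed
    have 2: "w x powr (p - 1) / w x = w x powr (p - 2)"
      using wpos[OF that] powr_diff[of "w x" "p - 1" 1] by simp
    have "G x \<bullet> H' x v = w x powr (p - 2) * (G x \<bullet> S x v) + (p - 2) * (w x powr (p - 4) * (w x)\<^sup>2) * (G x \<bullet> S x v)"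
      unfolding H'_alt[OF that] by (simp add: inner_add_right w_def dot_square_norm)
    also have "\<dots> = (p - 1) * (w x powr (p - 1) / w x) * (G x \<bullet> S x v)"
      unfolding 1 2 by (simp add: algebra_simps)
    finally show ?thesis using p by (simp add: F'_def w'_def)
  qed

  \<comment> \<open>Up to the positive factor \<open>w x powr (p - 2)\<close>, the map
    \<open>H' x\<close> is the Hessian followed by a rank-one perturbation of the identity with
    coefficient \<open>p - 2\<close>, which exceeds -1 because \<open>p > 1\<close>.\<close>
  have trace_ineq: "(g x)\<^sup>2 \<le> n * ltrace (\<lambda>v. H' x (H' x v))" if x: "x \<noteq> 0" for x
  proof -
    define e where "e = G x /\<^sub>R w x"
    define D where "D = (\<lambda>v. S x v + ((p - 2) * (S x v \<bullet> e)) *\<^sub>R e)"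
    have HD: "H' x = (\<lambda>v. w x powr (p - 2) *\<^sub>R D v)"
    proof
      fix v
      have "w x powr (p - 4) = w x powr (p - 2) / (w x * w x)"
        using wpos[OF x] powr_diff[of "w x" "p - 2" 2] by (simp add: power2_eq_square)
      then show "H' x v = w x powr (p - 2) *\<^sub>R D v" unfolding H'_alt[OF x] D_def e_def
        by (simp add: scaleR_right_distrib inner_commute field_simps)
    qed
    have "linear D"
      unfolding D_def using linS[OF x]
      by (intro linearI) (auto simp: linear_add linear_cmul inner_add_left algebra_simps)
    then have DD: "H' x (H' x v) = (w x powr (p - 2) * w x powr (p - 2)) *\<^sub>R D (D v)" for v
      unfolding HD by (simp add: linear_cmul)
    have "(ltrace D)\<^sup>2 \<le> (real DIM('a) - 1) * ltrace (\<lambda>v. D (D v))"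
    proof (rule ltrace_square_rank_one_perturbation[OF linS[OF x] symS[OF x] Sx[OF x] x, of e "p - 2" D])
      show "norm e = 1" using wpos[OF x] by (simp add: e_def w_def)
    qed (use p in \<open>auto simp: D_def\<close>)
    then have "(w x powr (p - 2))\<^sup>2 * (ltrace D)\<^sup>2 \<le> (w x powr (p - 2))\<^sup>2 * (n * ltrace (\<lambda>v. D (D v)))"
      unfolding n_def by (intro mult_left_mono) auto
    then show ?thesis
      unfolding g_def DD by (simp add: HD ltrace_scaleR power_mult_distrib power2_eq_square mult_ac)
  qed

  \<comment> \<open>Since \<open>n + 1\<close> is the dimension, \<open>\<rho>\<close> has exactly
    the degree that \<open>sphere_int\<close> requires. It serves as common weight, and its
    cofactors in all integrands have degree zero.\<close>
  define \<rho> where "\<rho> = (\<lambda>x. f x powr (- n - 1))"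
  have \<rho>pos: "\<rho> x > 0" if "x \<noteq> 0" for x using pos[OF that] by (simp add: \<rho>_def)
  have \<rho>1: "f x powr (- n) = \<rho> x * f x" if "x \<noteq> 0" for x
    using pos[OF that] powr_add[of "f x" "- n - 1" 1] by (simp add: \<rho>_def)
  have \<rho>2: "f x powr (1 - n) = \<rho> x * (f x)\<^sup>2" if "x \<noteq> 0" for x
    using pos[OF that] powr_add[of "f x" "- n - 1" 2] by (simp add: \<rho>_def)
  define K where "K = (\<lambda>x. k - (n - m) * F x)"

  have cf: "continuous_on (- {0}) f" "continuous_on (- {0}) F" "continuous_on (- {0}) H"
    using C1_off0_continuous[OF f] C1_off0_continuous[OF F] C1_off0_continuous[OF H] by auto
  have c\<rho>: "continuous_on (- {0}) \<rho>"
    unfolding \<rho>_def using cf pos by (intro continuous_on_powr continuous_intros) force+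
  have cg: "continuous_on (- {0}) g"
    unfolding g_def using H by (intro continuous_on_ltrace) (simp add: C1_off0_def)
  have cK: "continuous_on (- {0}) K" unfolding K_def by (intro continuous_intros cf)
  have cFH: "continuous_on (- {0}) (\<lambda>x. F' x (H x))" by (rule C1_off0_continuous_apply[OF F cf(3)])
  have cHH: "continuous_on (- {0}) (\<lambda>x. ltrace (\<lambda>v. H' x (H' x v)))"
    using H by (intro continuous_on_ltrace C1_off0_continuous_apply[OF H]) (simp add: C1_off0_def)

  have f_powr: "C1_off0 (\<lambda>x. f x powr s) (\<lambda>x v. s * f x powr (s - 1) * (G x \<bullet> v))" for s
    by (rule C1_off0_powr[OF f pos])
  have lin_powr: "linear (\<lambda>v. s * f x powr (s - 1) * (G x \<bullet> v))" for s x
    by (rule linearI) (auto simp: inner_add_right algebra_simps)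

  \<comment> \<open>The divergence of \<open>f powr (- n)\<close> times \<open>H\<close> is
    \<open>\<rho> x * (f x * g x - n * F x)\<close>, and the equation turns the bracket into
    \<open>K x\<close>; this is where \<open>K\<close> comes from.\<close>
  have E1: "sphere_int (\<lambda>x. \<rho> x * K x) = 0"
  proof -
    note C = C1_off0_scaleR[OF f_powr[of "- n"] H]
    have "sphere_int (\<lambda>x. ltrace (\<lambda>v. f x powr (- n) *\<^sub>R H' x v + (- n * f x powr (- n - 1) * (G x \<bullet> v)) *\<^sub>R H x)) = 0"
    proof (rule sphere_int_divergence[OF C])
      show "l ^ (DIM('a) - 1) *\<^sub>R f (l *\<^sub>R x) powr (- n) *\<^sub>R H (l *\<^sub>R x) = f x powr (- n) *\<^sub>R H x"
        if "l > 0" "x \<noteq> 0" for l x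
        using hom[OF that] H_hom[OF that] powr_scale_cancel[OF that(1) pos[OF that(2)], of "- n" "DIM('a) - 1"] dim
        by (simp add: n_def of_nat_diff)
    qed
    moreover have "ltrace (\<lambda>v. f x powr (- n) *\<^sub>R H' x v + (- n * f x powr (- n - 1) * (G x \<bullet> v)) *\<^sub>R H x) = \<rho> x * K x"
      if x: "x \<noteq> 0" for x
    proof -
      have "ltrace (\<lambda>v. f x powr (- n) *\<^sub>R H' x v + (- n * f x powr (- n - 1) * (G x \<bullet> v)) *\<^sub>R H x)
        = \<rho> x * f x * g x - n * \<rho> x * F x"
        by (simp only: ltrace_add ltrace_scaleR ltrace_rank_one[OF lin_powr] GH[OF x] \<rho>1[OF x] g_def) (simp add: \<rho>_def)
      also have "\<dots> = \<rho> x * (f x * g x - n * F x)" by (simp add: algebra_simps)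
      finally show ?thesis unfolding g_eq[OF x] by (simp add: K_def algebra_simps)
    qed
    ultimately show ?thesis by (rule sphere_int_eq_0_cong)
  qed

  \<comment> \<open>The extra factor \<open>F\<close> produces the term \<open>F' x (H x)\<close>,
    which also occurs in the trace identity and has no sign of its own; this relation trades it for
    \<open>F x * K x\<close>.\<close>
  have E2: "sphere_int (\<lambda>x. \<rho> x * f x * F' x (H x) + \<rho> x * F x * K x) = 0"
  proof -
    define h where "h = (\<lambda>x. f x powr (- n) *\<^sub>R F x)"
    define h' where "h' = (\<lambda>x v. f x powr (- n) *\<^sub>R F' x v + (- n * f x powr (- n - 1) * (G x \<bullet> v)) *\<^sub>R F x)"
    have h: "C1_off0 h h'" unfolding h_def h'_def by (rule C1_off0_scaleR[OF f_powr[of "- n"] F])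
    have "sphere_int (\<lambda>x. ltrace (\<lambda>v. h x *\<^sub>R H' x v + h' x v *\<^sub>R H x)) = 0"
    proof (rule sphere_int_divergence[OF C1_off0_scaleR[OF h H]])
      show "l ^ (DIM('a) - 1) *\<^sub>R h (l *\<^sub>R x) *\<^sub>R H (l *\<^sub>R x) = h x *\<^sub>R H x"
        if "l > 0" "x \<noteq> 0" for l x
        using hom[OF that] H_hom[OF that] w_hom[OF that] powr_scale_cancel[OF that(1) pos[OF that(2)], of "- n" "DIM('a) - 1"] dim
        by (simp add: n_def of_nat_diff h_def F_def mult.assoc[symmetric])
    qed
    moreover have "ltrace (\<lambda>v. h x *\<^sub>R H' x v + h' x v *\<^sub>R H x) = \<rho> x * f x * F' x (H x) + \<rho> x * F x * K x"
      if x: "x \<noteq> 0" for x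
    proof -
      have "ltrace (\<lambda>v. h x *\<^sub>R H' x v + h' x v *\<^sub>R H x) = h x * g x + h' x (H x)"
        by (simp only: ltrace_add ltrace_scaleR ltrace_rank_one[OF C1_off0_linear[OF h x]] g_def)
      also have "\<dots> = \<rho> x * f x * F x * g x + (\<rho> x * f x * F' x (H x) - n * \<rho> x * F x * F x)"
        using GH[OF x] \<rho>1[OF x] by (simp add: h_def h'_def \<rho>_def)
      also have "\<dots> = \<rho> x * f x * F' x (H x) + \<rho> x * F x * (f x * g x - n * F x)"
        by (simp add: algebra_simps)
      finally show ?thesis unfolding g_eq[OF x] by (simp add: K_def algebra_simps)
    qed
    ultimately show ?thesis by (rule sphere_int_eq_0_cong)
  qed

  \<comment> \<open>The trace identity with \<open>X = f powr (1 - n) H\<close> and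
    \<open>Y = H\<close>. The exponent \<open>1 - n\<close> is minus \<open>DIM('a) - 2\<close>, as
    required of the first field.\<close>
  have E3: "sphere_int (\<lambda>x. \<rho> x * (f x)\<^sup>2 * ltrace (\<lambda>v. H' x (H' x v)) - (n - 1) * ((p - 1) / p) * (\<rho> x * f x * F' x (H x))
      - (\<rho> x * (f x)\<^sup>2 * g x - (n - 1) * \<rho> x * f x * F x) * g x) = 0"
  proof -
    define X' where "X' = (\<lambda>x v. f x powr (1 - n) *\<^sub>R H' x v + ((1 - n) * f x powr (1 - n - 1) * (G x \<bullet> v)) *\<^sub>R H x)"
    have X: "C1_off0 (\<lambda>x. f x powr (1 - n) *\<^sub>R H x) X'"
      unfolding X'_def by (rule C1_off0_scaleR[OF f_powr[of "1 - n"] H])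
    have cX: "continuous_on (- {0}) (\<lambda>x. ltrace (X' x))"
      using X by (intro continuous_on_ltrace) (simp add: C1_off0_def)
    have cXH: "continuous_on (- {0}) (\<lambda>x. ltrace (\<lambda>v. X' x (H' x v)))"
      using H by (intro continuous_on_ltrace C1_off0_continuous_apply[OF X]) (simp add: C1_off0_def)
    have "sphere_int (\<lambda>x. ltrace (\<lambda>v. X' x (H' x v))) = sphere_int (\<lambda>x. ltrace (X' x) * ltrace (H' x))"
    proof (rule sphere_int_trace_product[OF _ X H _ H_hom])
      show "DIM('a) \<ge> 2" using dim by simp
      show "l ^ (DIM('a) - 2) *\<^sub>R f (l *\<^sub>R x) powr (1 - n) *\<^sub>R H (l *\<^sub>R x) = f x powr (1 - n) *\<^sub>R H x"
        if "l > 0" "x \<noteq> 0" for l x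
        using hom[OF that] H_hom[OF that] powr_scale_cancel[OF that(1) pos[OF that(2)], of "1 - n" "DIM('a) - 2"] dim
        by (simp add: n_def of_nat_diff)
    qed
    then have "sphere_int (\<lambda>x. ltrace (\<lambda>v. X' x (H' x v)) - ltrace (X' x) * g x) = 0"
      using cX cXH cg by (subst sphere_int_diff) (auto intro!: continuous_intros simp: g_def)
    moreover have "ltrace (\<lambda>v. X' x (H' x v)) - ltrace (X' x) * g x =
      \<rho> x * (f x)\<^sup>2 * ltrace (\<lambda>v. H' x (H' x v)) - (n - 1) * ((p - 1) / p) * (\<rho> x * f x * F' x (H x))
      - (\<rho> x * (f x)\<^sup>2 * g x - (n - 1) * \<rho> x * f x * F x) * g x" if x: "x \<noteq> 0" for x
    proof -
      have \<rho>1': "f x powr (1 - n - 1) = \<rho> x * f x" using \<rho>1[OF x] by simp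
      have l: "linear (\<lambda>v. (1 - n) * f x powr (1 - n - 1) * (G x \<bullet> H' x v))"
        using linH[OF x] by (intro linearI) (auto simp: linear_add linear_cmul inner_add_right algebra_simps)
      have 1: "ltrace (X' x) = \<rho> x * (f x)\<^sup>2 * g x - (n - 1) * \<rho> x * f x * F x"
        unfolding X'_def
        by (simp only: ltrace_add ltrace_scaleR ltrace_rank_one[OF lin_powr],
            simp only: GH[OF x] \<rho>2[OF x] \<rho>1' g_def) (simp add: algebra_simps)
      have 2: "ltrace (\<lambda>v. X' x (H' x v)) = \<rho> x * (f x)\<^sup>2 * ltrace (\<lambda>v. H' x (H' x v)) - (n - 1) * ((p - 1) / p) * (\<rho> x * f x * F' x (H x))"
        unfolding X'_def
        by (simp only: ltrace_add ltrace_scaleR ltrace_rank_one[OF l],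
            simp only: GH'[OF x] \<rho>2[OF x] \<rho>1') (use p in \<open>simp add: field_simps\<close>)
      show ?thesis unfolding 1 2 ..
    qed
    ultimately show ?thesis by (rule sphere_int_eq_0_cong)
  qed

  \<comment> \<open>Positivity of \<open>\<theta>\<close> is the lower bound on
    \<open>m\<close>.\<close>
  define \<theta> where "\<theta> = m / n - (p - 1) / p"
  have \<theta>: "\<theta> > 0"
    using m n2 p by (simp add: \<theta>_def field_simps)
  \<comment> \<open>The multiple \<open>c2\<close> of the second relation cancels
    \<open>F' x (H x)\<close>. Substituting \<open>F x = (k - K x) / (n - m)\<close> in the rest
    leaves \<open>c0 * K x - c1 * (K x)\<^sup>2\<close>. The linear part integrates to zero by the
    first relation, whatever the sign of \<open>c0\<close>.\<close>
  define c0 where "c0 = (n - 1) * (\<theta> * k / (n - m) + k / n)"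
  define c1 where "c1 = (n - 1) * \<theta> / (n - m)"
  define c2 where "c2 = (n - 1) * ((p - 1) / p)"
  have c1: "c1 > 0" unfolding c1_def using \<theta> m n2 by simp
  \<comment> \<open>Both summands are nonnegative, the first by the trace inequality and the second
    by \<open>c1 > 0\<close>; \<open>a\<close> is a combination of the three integrands whose
    integrals vanish.\<close>
  define a where "a = (\<lambda>x. \<rho> x * (f x)\<^sup>2 * (ltrace (\<lambda>v. H' x (H' x v)) - (g x)\<^sup>2 / n) + c1 * (\<rho> x * (K x)\<^sup>2))"
  have ca: "continuous_on (- {0}) a"
    unfolding a_def by (intro continuous_intros c\<rho> cf cHH cg cK) (use n2 in auto)
  have a_eq: "a x = (\<rho> x * (f x)\<^sup>2 * ltrace (\<lambda>v. H' x (H' x v)) - (n - 1) * ((p - 1) / p) * (\<rho> x * f x * F' x (H x))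
      - (\<rho> x * (f x)\<^sup>2 * g x - (n - 1) * \<rho> x * f x * F x) * g x)
      + (c2 * (\<rho> x * f x * F' x (H x) + \<rho> x * F x * K x) + c0 * (\<rho> x * K x))" if x: "x \<noteq> 0" for x
  proof -
    have K': "K x = f x * g x - n * F x" unfolding g_eq[OF x] K_def by (simp add: algebra_simps)
    have Fx: "F x = (k - K x) / (n - m)" using m unfolding K_def by simp
    have "(f x * g x)\<^sup>2 / n * (n - 1) - (n - 1) * F x * (f x * g x) = (n - 1) * (f x * g x) * K x / n"
      unfolding K' using n2 by (simp add: field_simps power2_eq_square)
    also have "\<dots> = (n - 1) * (m * F x + k) * K x / n" unfolding g_eq[OF x] ..
    finally have 1: "(f x * g x)\<^sup>2 / n * (n - 1) - (n - 1) * F x * (f x * g x) - c2 * F x * K x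
       = (n - 1) * (m * F x + k) * K x / n - c2 * F x * K x" by simp
    also have "\<dots> = (n - 1) * (\<theta> * F x + k / n) * K x"
      using n2 p unfolding c2_def \<theta>_def by (simp add: field_simps)
    finally have 1: "(f x * g x)\<^sup>2 / n * (n - 1) - (n - 1) * F x * (f x * g x) - c2 * F x * K x
       = (n - 1) * (\<theta> * F x + k / n) * K x" .
    have "(n - 1) * (\<theta> * F x + k / n) * K x = c0 * K x - c1 * (K x)\<^sup>2"
    proof -
      have *: "(n - 1) * (\<theta> * ((k - z) * i) + k * j) * z = (n - 1) * (\<theta> * k * i + k * j) * z - (n - 1) * \<theta> * i * z\<^sup>2"
        for i j z :: real by (simp add: algebra_simps power2_eq_square)
      show ?thesis
        using *[of "K x" "inverse (n - m)" "inverse n"] by (simp only: Fx c0_def c1_def divide_inverse)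
    qed
    with 1 have 2: "(f x * g x)\<^sup>2 / n * (n - 1) - (n - 1) * F x * (f x * g x) - c2 * F x * K x
       = c0 * K x - c1 * (K x)\<^sup>2" by simp
    have "- ((f x)\<^sup>2 * (g x)\<^sup>2 / n) + c1 * (K x)\<^sup>2
       = - ((f x)\<^sup>2 * (g x)\<^sup>2) + (n - 1) * f x * F x * g x + c2 * F x * K x + c0 * K x"
    proof -
      have "(f x * g x)\<^sup>2 / n * (n - 1) = (f x)\<^sup>2 * (g x)\<^sup>2 - (f x)\<^sup>2 * (g x)\<^sup>2 / n"
        using n2 by (simp add: field_simps power_mult_distrib)
      then show ?thesis using 2 by (simp add: algebra_simps)
    qed
    then have "\<rho> x * (- ((f x)\<^sup>2 * (g x)\<^sup>2 / n) + c1 * (K x)\<^sup>2)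
       = \<rho> x * (- ((f x)\<^sup>2 * (g x)\<^sup>2) + (n - 1) * f x * F x * g x + c2 * F x * K x + c0 * K x)"
      by simp
    then show ?thesis
      unfolding a_def c2_def[symmetric] by (simp add: algebra_simps power2_eq_square)
  qed
  define e1 where "e1 = (\<lambda>x. \<rho> x * K x)"
  define e2 where "e2 = (\<lambda>x. \<rho> x * f x * F' x (H x) + \<rho> x * F x * K x)"
  define e3 where "e3 = (\<lambda>x. \<rho> x * (f x)\<^sup>2 * ltrace (\<lambda>v. H' x (H' x v)) - (n - 1) * ((p - 1) / p) * (\<rho> x * f x * F' x (H x))
      - (\<rho> x * (f x)\<^sup>2 * g x - (n - 1) * \<rho> x * f x * F x) * g x)"
  have ce: "continuous_on (- {0}) e1" "continuous_on (- {0}) e2" "continuous_on (- {0}) e3"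
    unfolding e1_def e2_def e3_def by (intro continuous_intros c\<rho> cf cHH cg cK cFH)+
  have "sphere_int a = sphere_int (\<lambda>x. e3 x + (c2 * e2 x + c0 * e1 x))"
    unfolding e1_def e2_def e3_def by (rule sphere_int_cong) (rule a_eq)
  also have "\<dots> = sphere_int e3 + sphere_int (\<lambda>x. c2 * e2 x + c0 * e1 x)"
    by (rule sphere_int_add) (intro continuous_on_add continuous_on_mult continuous_on_const ce)+
  also have "sphere_int (\<lambda>x. c2 * e2 x + c0 * e1 x) = sphere_int (\<lambda>x. c2 * e2 x) + sphere_int (\<lambda>x. c0 * e1 x)"
    by (rule sphere_int_add) (intro continuous_on_mult continuous_on_const ce)+
  also have "sphere_int e3 + \<dots> = 0"
    unfolding sphere_int_cmult using E1 E2 E3 by (simp add: e1_def e2_def e3_def)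
  finally have Ta: "sphere_int a = 0" .
  have parts: "\<rho> x * (f x)\<^sup>2 * (ltrace (\<lambda>v. H' x (H' x v)) - (g x)\<^sup>2 / n) \<ge> 0" "c1 * (\<rho> x * (K x)\<^sup>2) \<ge> 0"
    if x: "x \<noteq> 0" for x
  proof -
    have "(g x)\<^sup>2 / n \<le> ltrace (\<lambda>v. H' x (H' x v))"
      using trace_ineq[OF x] n2 by (simp add: field_simps)
    then show "\<rho> x * (f x)\<^sup>2 * (ltrace (\<lambda>v. H' x (H' x v)) - (g x)\<^sup>2 / n) \<ge> 0"
      using \<rho>pos[OF x] by simp
    show "c1 * (\<rho> x * (K x)\<^sup>2) \<ge> 0" using c1 \<rho>pos[OF x] by simp
  qed
  \<comment> \<open>A vanishing integral gives information only for norms strictly between 1 and 2,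
    so \<open>x\<close> is rescaled to norm 3/2; \<open>w\<close> is unchanged because
    \<open>G\<close> has degree zero.\<close>
  define y where "y = (3 / 2 / norm x) *\<^sub>R x"
  have y0: "y \<noteq> 0" using x by (simp add: y_def)
  have "a y = 0"
  proof (rule sphere_int_eq_0_imp[OF ca _ Ta])
    show "a x \<ge> 0" if "x \<noteq> 0" for x unfolding a_def using parts[OF that] by simp
  qed (use x in \<open>auto simp: y_def\<close>)
  then have "c1 * (\<rho> y * (K y)\<^sup>2) = 0" using parts[OF y0] unfolding a_def by linarith
  then have "K y = 0" using c1 \<rho>pos[OF y0] by simp
  moreover have "w y = w x" unfolding y_def by (rule w_hom) (use x in auto)
  ultimately show ?thesis using m by (simp add: K_def F_def w_def field_simps)
qed

lemma homogeneous_constant_gradient_norm: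
  fixes f :: "'a::euclidean_space \<Rightarrow> real"
  assumes f: "C1_off0 f (\<lambda>x v. G x \<bullet> v)"
    and hom: "\<And>l x. l > 0 \<Longrightarrow> x \<noteq> 0 \<Longrightarrow> f (l *\<^sub>R x) = l * f x"
    and pos: "\<And>x. x \<noteq> 0 \<Longrightarrow> f x > 0"
    and Gx: "\<And>x. x \<noteq> 0 \<Longrightarrow> G x \<bullet> x = f x"
    and c: "\<And>x. x \<noteq> 0 \<Longrightarrow> norm (G x) = c"
  shows "\<forall>x\<in>sphere 0 1. f x = c"
proof -
  have le: "f x \<le> c" if "x \<in> sphere 0 1" for x
  proof -
    have "x \<noteq> 0" using that by auto
    then show ?thesis using norm_cauchy_schwarz[of "G x" x] Gx[of x] c[of x] that by simp
  qed
  have "continuous_on (sphere 0 1) f"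
    by (rule continuous_on_subset[OF C1_off0_continuous[OF f]]) auto
  moreover obtain b :: 'a where "b \<in> Basis" using nonempty_Basis by blast
  then have "sphere (0::'a) 1 \<noteq> {}" by (metis dist_0_norm empty_iff mem_sphere norm_Basis)
  ultimately obtain z where z: "z \<in> sphere 0 1" "\<And>y. y \<in> sphere 0 1 \<Longrightarrow> f z \<le> f y"
    using continuous_attains_inf[of "sphere 0 1" f] by auto
  have z0: "z \<noteq> 0" and nz: "norm z = 1" using z by auto
  \<comment> \<open>Homogeneity turns the minimum over the sphere into an unconstrained minimum of
    \<open>f y - f z * norm y\<close> at \<open>z\<close>. Its critical point equation says that
    \<open>G z\<close> is the multiple \<open>f z\<close> of \<open>z\<close>, without a Lagrange
    multiplier.\<close>
  have lower: "f z * norm y \<le> f y" if "y \<noteq> 0" for y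
  proof -
    have "f y = norm y * f (y /\<^sub>R norm y)"
      using hom[of "norm y" "y /\<^sub>R norm y"] that by simp
    moreover have "f z \<le> f (y /\<^sub>R norm y)" using that by (intro z(2)) simp
    ultimately show ?thesis using that by (simp add: mult.commute mult_left_mono)
  qed
  have "((\<lambda>y. f y - f z * norm y) has_derivative (\<lambda>v. G z \<bullet> v - f z * (v \<bullet> sgn z))) (at z)"
    by (intro has_derivative_diff has_derivative_mult_right C1_off0_derivative[OF f] has_derivative_norm z0)
  from differential_zero_maxmin[OF _ _ this, of "- {0}"]
  have "(\<lambda>v. G z \<bullet> v - f z * (v \<bullet> sgn z)) = (\<lambda>v. 0)"
    using z0 lower nz by auto
  then have "G z \<bullet> v - f z * (v \<bullet> sgn z) = 0" for v by meson
  then have "(G z - f z *\<^sub>R z) \<bullet> v = 0" for v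
    using nz by (simp add: inner_diff_left inner_commute[of z] sgn_div_norm)
  from this[of "G z - f z *\<^sub>R z"]
  have "G z = f z *\<^sub>R z" by simp
  then have "c = f z" using c[OF z0] nz pos[OF z0] by simp
  then show ?thesis using le z(2) by force
qed

section \<open>The equation on the sphere\<close>

lemma has_derivative_sgn:
  fixes x :: "'a::euclidean_space"
  assumes "x \<noteq> 0"
  shows "(sgn has_derivative (\<lambda>v. (1 / norm x) *\<^sub>R tangent_proj (sgn x) v)) (at x)"
proof -
  have "((\<lambda>y. inverse (norm y)) has_derivative (\<lambda>v. - (inverse (norm x) * (v \<bullet> sgn x) * inverse (norm x)))) (at x)"
    using Deriv.has_derivative_inverse[OF _ has_derivative_norm[OF assms]] assms by simp
  from has_derivative_scaleR[OF this has_derivative_ident]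
  have "((\<lambda>y. inverse (norm y) *\<^sub>R y) has_derivative (\<lambda>v. inverse (norm x) *\<^sub>R v + (- (inverse (norm x) * (v \<bullet> sgn x) * inverse (norm x))) *\<^sub>R x)) (at x)" .
  moreover have "(\<lambda>y. inverse (norm y) *\<^sub>R y) = (sgn :: 'a \<Rightarrow> 'a)" by (simp add: sgn_div_norm fun_eq_iff)
  moreover have "inverse (norm x) *\<^sub>R v + (- (inverse (norm x) * (v \<bullet> sgn x) * inverse (norm x))) *\<^sub>R x
     = (1 / norm x) *\<^sub>R tangent_proj (sgn x) v" for v
    by (simp add: tangent_proj_def sgn_div_norm scaleR_diff_right divide_inverse mult_ac)
  ultimately show ?thesis by simp
qed

lemma linear_sphere_deriv:
  assumes "f differentiable_on sphere 0 1" "norm x = 1"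
  shows "linear (sphere_deriv f x)"
proof -
  have "(f has_derivative frechet_derivative f (at x within sphere 0 1)) (at x within sphere 0 1)"
    using assms by (simp add: differentiable_on_def frechet_derivative_works[symmetric])
  from linear_compose[OF linear_tangent_proj has_derivative_linear[OF this]]
  show ?thesis by (simp add: o_def sphere_deriv_def[abs_def])
qed

text \<open>\<open>sgn\<close> maps the punctured space into the sphere, so a derivative within the
  sphere is enough for the chain rule. The projection built into \<open>sphere_deriv\<close> is the
  one produced by differentiating \<open>sgn\<close>.\<close>

lemma C1_off0_radial_extension:
  fixes f :: "'a::euclidean_space \<Rightarrow> 'b::real_normed_vector"
  assumes d: "f differentiable_on sphere 0 1" and c: "\<And>v. continuous_on (sphere 0 1) (\<lambda>x. sphere_deriv f x v)"
  shows "C1_off0 (\<lambda>x. f (sgn x)) (\<lambda>x v. (1 / norm x) *\<^sub>R sphere_deriv f (sgn x) v)"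
  unfolding C1_off0_def
proof (intro conjI allI impI)
  fix x :: 'a assume x: "x \<noteq> 0"
  have nx: "norm (sgn x) = 1" using x by (simp add: norm_sgn)
  have at: "at x within - {0} = at x"
    by (rule at_within_open) (use x in auto)
  have img: "sgn ` (- {0 :: 'a}) \<subseteq> sphere 0 1" by (auto simp: norm_sgn split: if_splits)
  have fd: "(f has_derivative frechet_derivative f (at (sgn x) within sphere 0 1)) (at (sgn x) within sphere 0 1)"
    using d nx by (simp add: differentiable_on_def frechet_derivative_works[symmetric])
  have "((\<lambda>x. f (sgn x)) has_derivative (\<lambda>v. frechet_derivative f (at (sgn x) within sphere 0 1)
       ((1 / norm x) *\<^sub>R tangent_proj (sgn x) v))) (at x within - {0})"
    by (rule has_derivative_in_compose[OF has_derivative_at_withinI[OF has_derivative_sgn[OF x]] has_derivative_subset[OF fd img]])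
  then show "((\<lambda>x. f (sgn x)) has_derivative (\<lambda>v. (1 / norm x) *\<^sub>R sphere_deriv f (sgn x) v)) (at x)"
    using x has_derivative_linear[OF fd] at
    by (simp add: sphere_deriv_def linear_cmul)
next
  fix v
  have "continuous_on (- {0 :: 'a}) sgn"
    by (intro continuous_intros) auto
  then show "continuous_on (- {0}) (\<lambda>x. (1 / norm x) *\<^sub>R sphere_deriv f (sgn x) v)"
    by (intro continuous_intros continuous_on_compose2[OF c]) (auto simp: norm_sgn split: if_splits)
qed

lemma radial_extension_gradient:
  fixes \<omega> :: "'a::euclidean_space \<Rightarrow> real"
  assumes C2: "sphere_Ck 2 \<omega>" and pos: "\<And>x. x \<in> sphere 0 1 \<Longrightarrow> \<omega> x > 0"
  obtains G S where "C1_off0 (\<lambda>x. norm x * \<omega> (sgn x) powr s) (\<lambda>x v. G x \<bullet> v)" "C1_off0 G S"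
proof -
  have C2': "sphere_Ck (Suc (Suc 0)) \<omega>" using C2 by (simp add: numeral_2_eq_2)
  define \<psi> where "\<psi> = (\<lambda>b x. sphere_deriv \<omega> x b)"
  have d\<omega>: "\<omega> differentiable_on sphere 0 1" using C2' by simp
  have d\<psi>: "\<psi> b differentiable_on sphere 0 1" "continuous_on (sphere 0 1) (\<lambda>x. sphere_deriv (\<psi> b) x v)" for b v
    using C2' by (auto simp: \<psi>_def)
  have c\<psi>: "continuous_on (sphere 0 1) (\<psi> b)" for b
    using d\<psi>(1) by (rule differentiable_imp_continuous_on)
  define u' where "u' = (\<lambda>x v. (1 / norm x) *\<^sub>R sphere_deriv \<omega> (sgn x) v)"
  have u: "C1_off0 (\<lambda>x. \<omega> (sgn x)) u'"
    unfolding u'_def by (rule C1_off0_radial_extension[OF d\<omega>]) (use c\<psi> in \<open>simp add: \<psi>_def\<close>)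
  have upos: "\<omega> (sgn x) > 0" if "x \<noteq> 0" for x
    using pos that by (simp add: norm_sgn)
  have nrm: "C1_off0 (\<lambda>x::'a. norm x) (\<lambda>x v. (x \<bullet> v) / norm x)"
    by (rule C1_off0_norm[OF C1_off0_ident])
  \<comment> \<open>The product rule for \<open>norm x * \<omega> (sgn x) powr s\<close>: the factor
    \<open>1 / norm x\<close> from differentiating \<open>sgn\<close> cancels \<open>norm x\<close>
    in the second summand. The tangential gradient is assembled from the components
    \<open>\<psi> b\<close>, whose extensions are of class C^1, so that \<open>G\<close> itself can
    be differentiated.\<close>
  define G where "G = (\<lambda>x. \<omega> (sgn x) powr s *\<^sub>R norm x powr (-1) *\<^sub>R x
    + \<omega> (sgn x) powr (s - 1) *\<^sub>R (\<Sum>b\<in>Basis. \<psi> b (sgn x) *\<^sub>R s *\<^sub>R b))"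
  have \<psi>1: "C1_off0 (\<lambda>x. \<psi> b (sgn x) *\<^sub>R s *\<^sub>R b)
      (\<lambda>x v. \<psi> b (sgn x) *\<^sub>R 0 + ((1 / norm x) *\<^sub>R sphere_deriv (\<psi> b) (sgn x) v) *\<^sub>R s *\<^sub>R b)" for b
    by (rule C1_off0_scaleR[OF C1_off0_radial_extension[OF d\<psi>] C1_off0_const])
  have npos: "norm x > 0" if "x \<noteq> 0" for x :: 'a using that by simp
  have "\<exists>S. C1_off0 G S"
    unfolding G_def
    by (rule exI) (rule C1_off0_add[OF C1_off0_scaleR[OF C1_off0_powr[OF u upos]
            C1_off0_scaleR[OF C1_off0_powr[OF nrm npos] C1_off0_ident]]
          C1_off0_scaleR[OF C1_off0_powr[OF u upos] C1_off0_sum[OF \<psi>1]]])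
  then obtain S where S: "C1_off0 G S" by blast
  have "C1_off0 (\<lambda>x. norm x *\<^sub>R \<omega> (sgn x) powr s)
    (\<lambda>x v. norm x *\<^sub>R (s * \<omega> (sgn x) powr (s - 1) * u' x v) + ((x \<bullet> v) / norm x) *\<^sub>R \<omega> (sgn x) powr s)"
    by (intro C1_off0_scaleR nrm C1_off0_powr[OF u upos])
  then have "C1_off0 (\<lambda>x. norm x *\<^sub>R \<omega> (sgn x) powr s) (\<lambda>x v. G x \<bullet> v)"
  proof (rule C1_off0_cong_derivative)
    fix x v :: 'a assume x: "x \<noteq> 0"
    have lin: "linear (sphere_deriv \<omega> (sgn x))"
      by (rule linear_sphere_deriv[OF d\<omega>]) (use x in \<open>simp add: norm_sgn\<close>)
    have "sphere_deriv \<omega> (sgn x) v = sphere_deriv \<omega> (sgn x) (\<Sum>b\<in>Basis. (v \<bullet> b) *\<^sub>R b)"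
      by (simp add: euclidean_representation)
    also have "\<dots> = (\<Sum>b\<in>Basis. \<psi> b (sgn x) * (b \<bullet> v))"
      using lin by (simp add: linear_sum linear_cmul \<psi>_def inner_commute mult.commute)
    finally have *: "s * sphere_deriv \<omega> (sgn x) v = (\<Sum>b\<in>Basis. \<psi> b (sgn x) *\<^sub>R s *\<^sub>R b) \<bullet> v"
      by (simp add: inner_sum_left sum_distrib_left mult_ac)
    have "G x \<bullet> v = \<omega> (sgn x) powr s * (norm x powr (-1) * (x \<bullet> v)) + \<omega> (sgn x) powr (s - 1) * (s * sphere_deriv \<omega> (sgn x) v)"
      unfolding * G_def by (simp add: inner_add_left)
    then show "norm x *\<^sub>R (s * \<omega> (sgn x) powr (s - 1) * u' x v) + ((x \<bullet> v) / norm x) *\<^sub>R \<omega> (sgn x) powr s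
     = G x \<bullet> v" using x by (simp add: u'_def powr_minus field_simps)
  qed
  then have "C1_off0 (\<lambda>x. norm x * \<omega> (sgn x) powr s) (\<lambda>x v. G x \<bullet> v)" by simp
  then show ?thesis using S by (rule that)
qed

text \<open>Projecting to the tangent space on both sides changes \<open>L\<close> by two rank-one
  maps, and in the trace this removes exactly the normal-normal entry. The result is the same for
  every extension of \<open>V\<close> differentiable at \<open>x\<close>.\<close>

lemma sphere_div_ambient:
  fixes V :: "'a::euclidean_space \<Rightarrow> 'a"
  assumes x: "norm x = 1" and Z: "(Z has_derivative L) (at x)" and eq: "\<And>y. norm y = 1 \<Longrightarrow> V y = Z y"
  shows "sphere_div V x = ltrace L - L x \<bullet> x"
proof -
  have "(Z has_derivative L) (at x within sphere 0 1)"
    using Z by (rule has_derivative_at_withinI)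
  then have V: "(V has_derivative L) (at x within sphere 0 1)"
    by (rule has_derivative_transform[rotated 2]) (use x eq in auto)
  have lin: "linear L" using Z by (rule has_derivative_linear)
  have xx: "x \<bullet> x = 1" using x by (simp add: dot_square_norm)
  have linP: "linear (\<lambda>v. - (L (tangent_proj x v) \<bullet> x))"
    using lin linear_tangent_proj[of x]
    by (intro linearI) (auto simp: linear_add linear_cmul inner_add_left)
  have "tangent_proj x (L (tangent_proj x v))
     = L v + (- (v \<bullet> x)) *\<^sub>R L x + (- (L (tangent_proj x v) \<bullet> x)) *\<^sub>R x" for v
    using lin by (simp add: tangent_proj_def linear_diff linear_cmul)
  then have "sphere_div V x = ltrace (\<lambda>v. L v + (- (v \<bullet> x)) *\<^sub>R L x + (- (L (tangent_proj x v) \<bullet> x)) *\<^sub>R x)"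
    unfolding sphere_div_def sphere_cov_deriv_def sphere_deriv_eq[OF x V] ltrace_def by simp
  also have "\<dots> = ltrace L - L x \<bullet> x - L (tangent_proj x x) \<bullet> x"
  proof -
    have l: "linear (\<lambda>v. - (v \<bullet> x))" by (rule linearI) (auto simp: inner_add_left)
    show ?thesis by (simp only: ltrace_add ltrace_rank_one[OF l] ltrace_rank_one[OF linP])
  qed
  also have "tangent_proj x x = 0" using xx by (simp add: tangent_proj_def)
  finally show ?thesis using lin by (simp add: linear_0)
qed

lemma sphere_grad_ambient:
  fixes f :: "'a::euclidean_space \<Rightarrow> real"
  assumes x: "norm x = 1" and F: "(F has_derivative (\<lambda>v. W \<bullet> v)) (at x)"
    and eq: "\<And>y. norm y = 1 \<Longrightarrow> f y = F y"
  shows "sphere_grad f x = W - (W \<bullet> x) *\<^sub>R x"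
proof -
  have "(F has_derivative (\<lambda>v. W \<bullet> v)) (at x within sphere 0 1)"
    using F by (rule has_derivative_at_withinI)
  then have f: "(f has_derivative (\<lambda>v. W \<bullet> v)) (at x within sphere 0 1)"
    by (rule has_derivative_transform[rotated 2]) (use x eq in auto)
  then have "f differentiable (at x within sphere 0 1)" by (auto simp: differentiable_def)
  note g = sphere_grad_inner[OF x this]
  have "sphere_grad f x \<bullet> v = (W - (W \<bullet> x) *\<^sub>R x) \<bullet> v" for v
    unfolding g(2) sphere_deriv_eq[OF x f]
    by (simp add: tangent_proj_def inner_diff_left inner_diff_right inner_commute)
  then show ?thesis using vector_eq_rdot by blast
qed

text \<open>
  The computation rests on \<open>\<alpha>\<^sup>2 \<omega>\<^sup>2 + |\<nabla>\<omega>|\<^sup>2\<close> being the square of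
  \<open>\<alpha> f powr (- \<alpha> - 1) |G|\<close> on the sphere.
\<close>

lemma sphere_equation_ambient:
  fixes \<omega> f :: "'a::euclidean_space \<Rightarrow> real" and p q N \<alpha> m l :: real
  defines "N \<equiv> real DIM('a) - 1"
  assumes f: "C1_off0 f (\<lambda>x v. G x \<bullet> v)" and G: "C1_off0 G S"
    and pos: "\<And>x. x \<noteq> 0 \<Longrightarrow> f x > 0"
    and hom: "\<And>l x. l > 0 \<Longrightarrow> x \<noteq> 0 \<Longrightarrow> f (l *\<^sub>R x) = l * f x"
    and \<omega>: "\<And>y. norm y = 1 \<Longrightarrow> \<omega> y = f y powr (- \<alpha>)"
    and \<alpha>: "\<alpha> > 0" "m = (\<alpha> + 1) * (p - 1)" "\<alpha> * q = m + 1" "l = \<alpha> * (N - m)"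
    and x: "norm x = 1"
    and eq: "sphere_div (\<lambda>y. ((\<alpha>\<^sup>2 * (\<omega> y)\<^sup>2 + (norm (sphere_grad \<omega> y))\<^sup>2) powr ((p - 2) / 2)) *\<^sub>R sphere_grad \<omega> y) x
      + \<bar>\<omega> x\<bar> powr (q - 1) * \<omega> x
      - l * (\<alpha>\<^sup>2 * (\<omega> x)\<^sup>2 + (norm (sphere_grad \<omega> x))\<^sup>2) powr ((p - 2) / 2) * \<omega> x = 0"
  shows "ltrace (\<lambda>v. norm (G x) powr (p - 2) *\<^sub>R S x v
        + ((p - 2) * norm (G x) powr (p - 2 - 1) * ((G x \<bullet> S x v) / norm (G x))) *\<^sub>R G x)
      = (m * norm (G x) powr p + \<alpha> powr (1 - p)) / f x"
proof -
  have Gx: "G x \<bullet> x = f x" if "x \<noteq> 0" for x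
    by (rule euler_homogeneous_1[OF f _ that]) (rule hom)
  have Gnz: "G x \<noteq> 0" if "x \<noteq> 0" for x using Gx[OF that] pos[OF that] by auto
  define w where "w = (\<lambda>x. norm (G x))"
  have w: "C1_off0 w (\<lambda>x v. (G x \<bullet> S x v) / norm (G x))" unfolding w_def by (rule C1_off0_norm[OF G Gnz])
  have wpos: "w x > 0" if "x \<noteq> 0" for x using Gnz[OF that] by (simp add: w_def)
  define H where "H = (\<lambda>x. norm (G x) powr (p - 2) *\<^sub>R G x)"
  define H' where "H' = (\<lambda>x v. norm (G x) powr (p - 2) *\<^sub>R S x v
        + ((p - 2) * norm (G x) powr (p - 2 - 1) * ((G x \<bullet> S x v) / norm (G x))) *\<^sub>R G x)"
  have H: "C1_off0 H H'"
    unfolding H_def H'_def by (rule C1_off0_norm_powr_scaleR[OF G Gnz])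
  have G_hom: "G (l *\<^sub>R x) = G x" if "l > 0" "x \<noteq> 0" for l x
    by (rule gradient_homogeneous_1[OF f _ that]) (rule hom)
  have H'x: "H' x x = 0" if "x \<noteq> 0" for x
    by (rule euler_homogeneous_0[OF H _ that]) (simp add: H_def G_hom)
  have nz: "y \<noteq> 0" if "norm y = 1" for y :: 'a using that by auto
  \<comment> \<open>The common factor of \<open>\<omega>\<close>, which is \<open>f\<close> times
    \<open>\<tau>\<close>, and of its gradient, which is \<open>- \<alpha> * \<tau>\<close> times
    the tangential part of \<open>G\<close>. In the sum of squares the radial part cancels.\<close>
  define \<tau> where "\<tau> = (\<lambda>y. f y powr (- \<alpha> - 1))"
  have \<tau>: "\<omega> y = f y * \<tau> y" "\<tau> y > 0" if y: "norm y = 1" for y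
    unfolding \<tau>_def \<omega>[OF y] using pos[OF nz[OF y]] powr_add[of "f y" 1 "- \<alpha> - 1"] by auto
  have grad: "sphere_grad \<omega> y = (- \<alpha> * \<tau> y) *\<^sub>R (G y - f y *\<^sub>R y)" if y: "norm y = 1" for y
  proof -
    have "((\<lambda>y. f y powr (- \<alpha>)) has_derivative (\<lambda>v. - \<alpha> * f y powr (- \<alpha> - 1) * (G y \<bullet> v))) (at y)"
      by (rule C1_off0_derivative[OF C1_off0_powr[OF f pos] nz[OF y]])
    then have "((\<lambda>y. f y powr (- \<alpha>)) has_derivative (\<lambda>v. ((- \<alpha> * \<tau> y) *\<^sub>R G y) \<bullet> v)) (at y)"
      by (simp add: \<tau>_def)
    from sphere_grad_ambient[OF y this \<omega>] show ?thesis
      using Gx[OF nz[OF y]] by (simp add: scaleR_diff_right)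
  qed
  have A: "(\<alpha>\<^sup>2 * (\<omega> y)\<^sup>2 + (norm (sphere_grad \<omega> y))\<^sup>2) powr ((p - 2) / 2) = (\<alpha> * \<tau> y * w y) powr (p - 2)"
    if y: "norm y = 1" for y
  proof -
    have "(norm (G y - f y *\<^sub>R y))\<^sup>2 = (w y)\<^sup>2 - (f y)\<^sup>2"
    proof -
      have "(G y - f y *\<^sub>R y) \<bullet> (G y - f y *\<^sub>R y) = G y \<bullet> G y - 2 * f y * (G y \<bullet> y) + f y * f y * (y \<bullet> y)"
        by (simp add: inner_diff_left inner_diff_right inner_commute algebra_simps)
      then show ?thesis
        unfolding Gx[OF nz[OF y]] dot_square_norm y w_def by (simp add: power2_eq_square)
    qed
    then have "(norm (sphere_grad \<omega> y))\<^sup>2 = (\<alpha> * \<tau> y)\<^sup>2 * ((w y)\<^sup>2 - (f y)\<^sup>2)"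
      unfolding grad[OF y] norm_scaleR power_mult_distrib power2_abs by simp
    then have "\<alpha>\<^sup>2 * (\<omega> y)\<^sup>2 + (norm (sphere_grad \<omega> y))\<^sup>2 = (\<alpha> * \<tau> y * w y)\<^sup>2"
      unfolding \<tau>(1)[OF y] by (simp add: power_mult_distrib algebra_simps)
    also have "\<dots> = (\<alpha> * \<tau> y * w y) powr 2"
      using \<alpha>(1) \<tau>(2)[OF y] wpos[OF nz[OF y]] by simp
    also have "((\<alpha> * \<tau> y * w y) powr 2) powr ((p - 2) / 2) = (\<alpha> * \<tau> y * w y) powr (p - 2)"
    proof -
      have "2 * ((p - 2) / 2) = p - 2" by simp
      then show ?thesis by (simp only: powr_powr)
    qed
    finally show ?thesis .
  qed
  define c where "c = \<alpha> powr (p - 1)"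
  have c: "c > 0" using \<alpha>(1) by (simp add: c_def)
  \<comment> \<open>The exponent \<open>(- \<alpha> - 1) * (p - 1)\<close> of \<open>f\<close> is
    \<open>- m\<close>, and the power of \<open>\<alpha>\<close> is collected in \<open>c\<close>,
    the reciprocal of the constant \<open>\<alpha> powr (1 - p)\<close> in the conclusion.\<close>
  have \<alpha>\<tau>: "\<alpha> * \<tau> y * (\<alpha> * \<tau> y * w y) powr (p - 2) = c * f y powr (- m) * w y powr (p - 2)"
    if y: "norm y = 1" for y
  proof -
    have t: "\<alpha> * \<tau> y > 0" using \<alpha>(1) \<tau>(2)[OF y] by simp
    have "\<alpha> * \<tau> y * (\<alpha> * \<tau> y * w y) powr (p - 2) = ((\<alpha> * \<tau> y) powr 1 * (\<alpha> * \<tau> y) powr (p - 2)) * w y powr (p - 2)"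
      using t wpos[OF nz[OF y]] by (simp add: powr_mult)
    also have "(\<alpha> * \<tau> y) powr 1 * (\<alpha> * \<tau> y) powr (p - 2) = (\<alpha> * \<tau> y) powr (p - 1)"
      unfolding powr_add[symmetric] by simp
    also have "\<dots> = c * f y powr (- m)"
    proof -
      have "(- \<alpha> - 1) * (p - 1) = - m" unfolding \<alpha>(2) by (simp add: algebra_simps)
      then show ?thesis using \<alpha>(1) by (simp add: c_def \<tau>_def powr_mult powr_powr)
    qed
    finally show ?thesis .
  qed
  define a where "a = (\<lambda>y. f y powr (- m))"
  define a' where "a' = (\<lambda>y v. - m * f y powr (- m - 1) * (G y \<bullet> v))"
  have a: "C1_off0 a a'" unfolding a_def a'_def by (rule C1_off0_powr[OF f pos])
  \<comment> \<open>The coefficient of the normal part of the flux. No formula for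
    \<open>\<theta>'\<close> is needed: \<open>\<theta>' x x\<close> enters both the full trace and
    the normal entry, and the two cancel.\<close>
  define \<theta> where "\<theta> = (\<lambda>y. f y powr (1 - m) *\<^sub>R w y powr (p - 2))"
  obtain \<theta>' where \<theta>: "C1_off0 \<theta> \<theta>'"
    unfolding \<theta>_def using C1_off0_scaleR[OF C1_off0_powr[OF f pos, of "1 - m"] C1_off0_powr[OF w wpos, of "p - 2"]] by blast
  \<comment> \<open>An ambient extension of the flux with tangential projection written out. It is
    built from \<open>H\<close> because degree zero gives \<open>H' x x = 0\<close>, which
    simplifies the normal entry.\<close>
  define Z where "Z = (\<lambda>y. (- c) *\<^sub>R (a y *\<^sub>R H y - \<theta> y *\<^sub>R y))"
  define Z' where "Z' = (\<lambda>y v. (- c) *\<^sub>R ((a y *\<^sub>R H' y v + a' y v *\<^sub>R H y) - (\<theta> y *\<^sub>R v + \<theta>' y v *\<^sub>R y)) + 0 *\<^sub>R (a y *\<^sub>R H y - \<theta> y *\<^sub>R y))"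
  have Z: "C1_off0 Z Z'"
    unfolding Z_def Z'_def
    by (intro C1_off0_scaleR[OF C1_off0_const] C1_off0_diff C1_off0_scaleR[OF a H] C1_off0_scaleR[OF \<theta> C1_off0_ident])
  have VZ: "((\<alpha>\<^sup>2 * (\<omega> y)\<^sup>2 + (norm (sphere_grad \<omega> y))\<^sup>2) powr ((p - 2) / 2)) *\<^sub>R sphere_grad \<omega> y = Z y"
    if y: "norm y = 1" for y
  proof -
    have "((\<alpha>\<^sup>2 * (\<omega> y)\<^sup>2 + (norm (sphere_grad \<omega> y))\<^sup>2) powr ((p - 2) / 2)) *\<^sub>R sphere_grad \<omega> y
       = (- (\<alpha> * \<tau> y * (\<alpha> * \<tau> y * w y) powr (p - 2))) *\<^sub>R (G y - f y *\<^sub>R y)"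
      unfolding A[OF y] unfolding grad[OF y] by (simp add: mult_ac)
    also have "\<dots> = (- c) *\<^sub>R ((f y powr (- m) * w y powr (p - 2)) *\<^sub>R G y - (f y powr (- m) * f y * w y powr (p - 2)) *\<^sub>R y)"
      unfolding \<alpha>\<tau>[OF y] by (simp add: scaleR_diff_right mult_ac)
    also have "f y powr (- m) * f y = f y powr (1 - m)"
      using pos[OF nz[OF y]] powr_add[of "f y" "- m" 1] by simp
    finally show ?thesis by (simp add: Z_def a_def H_def \<theta>_def w_def)
  qed
  have x0: "x \<noteq> 0" using nz[OF x] .
  have xx: "x \<bullet> x = 1" using x by (simp add: dot_square_norm)
  have fx: "f x > 0" using pos[OF x0] .
  have div: "sphere_div (\<lambda>y. ((\<alpha>\<^sup>2 * (\<omega> y)\<^sup>2 + (norm (sphere_grad \<omega> y))\<^sup>2) powr ((p - 2) / 2)) *\<^sub>R sphere_grad \<omega> y) x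
     = ltrace (Z' x) - Z' x x \<bullet> x"
    by (rule sphere_div_ambient[OF x C1_off0_derivative[OF Z x0] VZ])
  have GH: "G x \<bullet> H x = w x powr p"
  proof -
    have "G x \<bullet> H x = w x powr (p - 2) * (w x)\<^sup>2"
      by (simp add: H_def w_def dot_square_norm)
    also have "(w x)\<^sup>2 = w x powr 2" using wpos[OF x0] by simp
    finally show ?thesis unfolding powr_add[symmetric] by simp
  qed
  have f1: "f x powr (- m - 1) * f x = f x powr (- m)" "f x powr (- m) * f x = f x powr (1 - m)"
    using fx powr_add[of "f x" "- m - 1" 1] powr_add[of "f x" "- m" 1] by auto
  have tr: "ltrace (Z' x) = - c * (a x * ltrace (H' x) - m * f x powr (- m - 1) * w x powr p - \<theta> x * real DIM('a) - \<theta>' x x)"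
  proof -
    have "ltrace (Z' x) = - c * (a x * ltrace (H' x) + a' x (H x) + - (\<theta> x * ltrace (\<lambda>v::'a. v)) + - \<theta>' x x)"
    proof -
      have "Z' x = (\<lambda>v. (- c) *\<^sub>R (a x *\<^sub>R H' x v + a' x v *\<^sub>R H x + (- \<theta> x) *\<^sub>R v + (- \<theta>' x v) *\<^sub>R x))"
        unfolding Z'_def by (simp add: fun_eq_iff algebra_simps)
      moreover have l: "linear (\<lambda>v. - \<theta>' x v)"
        using C1_off0_linear[OF \<theta> x0] by (rule linear_compose_neg)
      ultimately show ?thesis
        by (simp only: ltrace_add ltrace_scaleR ltrace_rank_one[OF C1_off0_linear[OF a x0]] ltrace_rank_one[OF l]) simp
    qed
    moreover have "ltrace (\<lambda>v::'a. v) = real DIM('a)" by (simp add: ltrace_def)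
    ultimately show ?thesis by (simp add: a'_def GH)
  qed
  have n: "Z' x x \<bullet> x = - c * (- m * \<theta> x - \<theta> x - \<theta>' x x)"
  proof -
    have "H x \<bullet> x = w x powr (p - 2) * f x" using Gx[OF x0] by (simp add: H_def w_def)
    then have "a' x x * (H x \<bullet> x) = - m * ((f x powr (- m - 1) * f x) * f x * w x powr (p - 2))"
      using Gx[OF x0] by (simp add: a'_def mult_ac)
    also have "\<dots> = - m * \<theta> x" unfolding f1 by (simp add: \<theta>_def)
    finally show ?thesis
      unfolding Z'_def H'x[OF x0] by (simp add: inner_diff_left inner_add_left xx)
  qed
  have \<omega>q: "\<bar>\<omega> x\<bar> powr (q - 1) * \<omega> x = f x powr (- m - 1)"
  proof -
    have wp: "\<omega> x > 0" using fx by (simp add: \<omega>[OF x])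
    then have "\<bar>\<omega> x\<bar> powr (q - 1) * \<omega> x = \<omega> x powr q"
      using powr_add[of "\<omega> x" "q - 1" 1] by simp
    also have "\<dots> = f x powr (- (\<alpha> * q))" by (simp add: \<omega>[OF x] powr_powr)
    finally show ?thesis unfolding \<alpha>(3) by simp
  qed
  have lin: "l * (\<alpha>\<^sup>2 * (\<omega> x)\<^sup>2 + (norm (sphere_grad \<omega> x))\<^sup>2) powr ((p - 2) / 2) * \<omega> x = (N - m) * c * \<theta> x"
  proof -
    have "l * (\<alpha> * \<tau> x * w x) powr (p - 2) * \<omega> x = (N - m) * f x * (\<alpha> * \<tau> x * (\<alpha> * \<tau> x * w x) powr (p - 2))"
      unfolding \<alpha>(4) \<tau>(1)[OF x] by (simp add: mult_ac)
    also have "\<dots> = (N - m) * c * ((f x powr (- m) * f x) * w x powr (p - 2))"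
      unfolding \<alpha>\<tau>[OF x] by (simp add: mult_ac)
    finally show ?thesis unfolding A[OF x] f1 by (simp add: \<theta>_def)
  qed
  have "- c * (a x * ltrace (H' x) - m * f x powr (- m - 1) * w x powr p - \<theta> x * real DIM('a) - \<theta>' x x)
     - (- c * (- m * \<theta> x - \<theta> x - \<theta>' x x)) + f x powr (- m - 1) - (N - m) * c * \<theta> x = 0"
    using eq unfolding div tr n \<omega>q lin .
  \<comment> \<open>The terms with \<open>\<theta> x\<close> cancel: the trace contributes
    \<open>DIM('a)\<close>, the normal entry takes away \<open>m + 1\<close>, and the linear term of
    the equation takes away \<open>N - m\<close>. This cancellation is the reason for the value of
    \<open>lambda\<close>.\<close>
  then have "c * (a x * ltrace (H' x)) = f x powr (- m - 1) * (m * c * w x powr p + 1)"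
    unfolding N_def by (simp add: algebra_simps)
  also have "a x = f x powr (- m - 1) * f x" unfolding f1 a_def ..
  finally have "f x powr (- m - 1) * (c * (f x * ltrace (H' x))) = f x powr (- m - 1) * (m * c * w x powr p + 1)"
    by (simp add: mult_ac)
  then have "c * (f x * ltrace (H' x)) = m * c * w x powr p + 1" using fx by simp
  moreover have "c * \<alpha> powr (1 - p) = 1"
    using \<alpha>(1) unfolding c_def powr_add[symmetric] by simp
  ultimately have "c * (f x * ltrace (H' x)) = c * (m * w x powr p + \<alpha> powr (1 - p))"
    by (simp add: algebra_simps)
  then have "f x * ltrace (H' x) = m * w x powr p + \<alpha> powr (1 - p)" using c by simp
  then show ?thesis using fx unfolding H'_def w_def by (simp add: field_simps)
qed

text \<open>Multiplied by the positive number \<open>q + 1 - p\<close>, which is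
  \<open>p / \<alpha>\<close>, the bounds become linear in \<open>q\<close>: the lower one is
  equivalent to \<open>\<alpha> * q < n + 1\<close>, the upper one to
  \<open>n - p < p * \<alpha>\<close>. These are the two bounds on \<open>m\<close>.\<close>

lemma exponent_conditions:
  fixes n p q :: real
  assumes p: "1 < p" "p < n"
    and q: "(n + 1) * (p - 1) / (n + 1 - p) < q" "q < (n * p - n + p) / (n - p)"
  defines "\<alpha> \<equiv> alpha p q" and "m \<equiv> (alpha p q + 1) * (p - 1)"
  shows "\<alpha> > 0" "\<alpha> * q = m + 1" "m < n" "n * (p - 1) / p < m" "\<alpha> * (n + 1 - \<alpha> * q) = \<alpha> * (n - m)"
proof -
  have q1: "(n + 1) * (p - 1) < q * (n + 1 - p)" using q(1) p by (simp add: field_simps)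
  have q2: "q * (n - p) < n * p - n + p" using q(2) p by (simp add: field_simps)
  \<comment> \<open>Lowering the factor \<open>n + 1\<close> to \<open>n + 1 - p\<close> weakens the
    lower bound on \<open>q\<close> to \<open>q > p - 1\<close>, so that \<open>\<alpha>\<close> is
    positive.\<close>
  have "(n + 1 - p) * (p - 1) \<le> (n + 1) * (p - 1)" using p by (intro mult_right_mono) auto
  then have "(n + 1 - p) * (p - 1) < (n + 1 - p) * q" using q1 by (simp add: mult.commute)
  then have r: "q + 1 - p > 0" using p by (simp add: mult_less_cancel_left_pos)
  show a: "\<alpha> > 0" using r p by (simp add: \<alpha>_def alpha_def)
  have ar: "\<alpha> * (q + 1 - p) = p" using r by (simp add: \<alpha>_def alpha_def)
  show aq: "\<alpha> * q = m + 1" using ar unfolding m_def \<alpha>_def by (simp add: algebra_simps)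
  have "(\<alpha> * q) * (q + 1 - p) < (n + 1) * (q + 1 - p)"
  proof -
    have "(\<alpha> * q) * (q + 1 - p) = p * q" using ar by (simp add: mult_ac)
    also have "\<dots> < (n + 1) * (q + 1 - p)" using q1 by (simp add: algebra_simps)
    finally show ?thesis .
  qed
  then have "\<alpha> * q < n + 1" using r by (simp add: mult_less_cancel_right_pos)
  then show "m < n" using aq by simp
  have "(n - p) * (q + 1 - p) < p * (\<alpha> * (q + 1 - p))"
    unfolding ar using q2 by (simp add: algebra_simps)
  then have "(n - p) * (q + 1 - p) < (p * \<alpha>) * (q + 1 - p)" by (simp add: mult_ac)
  then have "n - p < p * \<alpha>" using r by (simp add: mult_less_cancel_right_pos)
  then have "n * (p - 1) < (p * (\<alpha> + 1)) * (p - 1)"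
    using p by (intro mult_strict_right_mono) (auto simp: algebra_simps)
  then show "n * (p - 1) / p < m" using p unfolding m_def \<alpha>_def by (simp add: field_simps)
  show "\<alpha> * (n + 1 - \<alpha> * q) = \<alpha> * (n - m)" unfolding aq by simp
qed

theorem theorem1p2:
  fixes \<omega> :: "'a::euclidean_space \<Rightarrow> real" and n :: nat and p q :: real
  assumes n: "n > 0" "DIM('a) = n + 1"
    and p: "1 < p" "p < real n"
    and q: "(real n + 1) * (p - 1) / (real n + 1 - p) < q"
           "q < (real n * p - real n + p) / (real n - p)"
    and C2: "sphere_Ck 2 \<omega>"
    and pos: "\<And>x. x \<in> sphere 0 1 \<Longrightarrow> \<omega> x > 0"
    and eq: "\<And>x. x \<in> sphere 0 1 \<Longrightarrow>
      sphere_div (\<lambda>y. (((alpha p q)\<^sup>2 * (\<omega> y)\<^sup>2 + (norm (sphere_grad \<omega> y))\<^sup>2) powr ((p - 2) / 2))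
                        *\<^sub>R sphere_grad \<omega> y) x
      + \<bar>\<omega> x\<bar> powr (q - 1) * \<omega> x
      - lambda n p q * ((alpha p q)\<^sup>2 * (\<omega> x)\<^sup>2 + (norm (sphere_grad \<omega> x))\<^sup>2) powr ((p - 2) / 2) * \<omega> x
      = 0"
  shows "\<omega> constant_on sphere 0 1"
proof -
  define \<alpha> where "\<alpha> = alpha p q"
  define m where "m = (\<alpha> + 1) * (p - 1)"
  note exps = exponent_conditions[OF p q, folded \<alpha>_def, folded m_def]
  have N: "real DIM('a) - 1 = real n" using n by simp
  define f where "f = (\<lambda>x. norm x * \<omega> (sgn x) powr (- 1 / \<alpha>))"
  obtain G S where f: "C1_off0 f (\<lambda>x v. G x \<bullet> v)" and G: "C1_off0 G S"
    unfolding f_def using radial_extension_gradient[OF C2 pos] by metis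
  have fpos: "f x > 0" if "x \<noteq> 0" for x
    using pos[of "sgn x"] that by (simp add: f_def norm_sgn)
  have hom: "f (l *\<^sub>R x) = l * f x" if "l > 0" "x \<noteq> 0" for l x
    using that by (simp add: f_def sgn_scaleR)
  have \<omega>: "\<omega> y = f y powr (- \<alpha>)" if y: "norm y = 1" for y
    using pos[of y] y exps(1) by (simp add: f_def sgn_div_norm powr_powr)
  define D where "D = (\<lambda>x v. norm (G x) powr (p - 2) *\<^sub>R S x v
        + ((p - 2) * norm (G x) powr (p - 2 - 1) * ((G x \<bullet> S x v) / norm (G x))) *\<^sub>R G x)"
  define k where "k = \<alpha> powr (1 - p)"
  have G_hom: "G (l *\<^sub>R x) = G x" if "l > 0" "x \<noteq> 0" for l x
    by (rule gradient_homogeneous_1[OF f _ that]) (rule hom)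
  have Gx: "G x \<bullet> x = f x" if "x \<noteq> 0" for x
    by (rule euler_homogeneous_1[OF f _ that]) (rule hom)
  have Gnz: "G x \<noteq> 0" if "x \<noteq> 0" for x using Gx[OF that] fpos[OF that] by auto
  have D: "C1_off0 (\<lambda>x. norm (G x) powr (p - 2) *\<^sub>R G x) D"
    unfolding D_def by (rule C1_off0_norm_powr_scaleR[OF G Gnz])
  have on_sphere: "ltrace (D x) = (m * norm (G x) powr p + k) / f x" if x: "norm x = 1" for x
    unfolding D_def k_def
  proof (rule sphere_equation_ambient[OF f G fpos hom \<omega> exps(1) m_def exps(2) _ x])
    show "lambda n p q = \<alpha> * (real DIM('a) - 1 - m)"
      unfolding N lambda_def \<alpha>_def[symmetric] by (rule exps(5))
  qed (use eq[of x] x in \<open>simp_all add: \<alpha>_def\<close>)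
  \<comment> \<open>The differential equation is known on the unit sphere only. Both sides have
    degree -1, since \<open>D\<close> differentiates a field of degree zero while \<open>f\<close>
    has degree one, so it extends along rays.\<close>
  have flat: "ltrace (D x) = (m * norm (G x) powr p + k) / f x" if x: "x \<noteq> 0" for x
  proof -
    define y where "y = sgn x"
    have y: "norm y = 1" "y \<noteq> 0" "x = norm x *\<^sub>R y" using x by (simp_all add: y_def norm_sgn sgn_div_norm)
    have "(1 * norm x) *\<^sub>R D (norm x *\<^sub>R y) v = D y v" for v
      by (rule derivative_homogeneous[OF D]) (use x y(2) in \<open>simp_all add: G_hom\<close>)
    then have "norm x * ltrace (D x) = ltrace (D y)"
      unfolding ltrace_scaleR[symmetric] y(3)[symmetric] by simp
    moreover have "G x = G y" "f x = norm x * f y"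
      using G_hom[of "norm x" y] hom[of "norm x" y] x y by simp_all
    ultimately show ?thesis
      using on_sphere[OF y(1)] x fpos[OF y(2)] by (simp add: field_simps)
  qed
  have norm_G: "norm (G x) powr p = k / (real n - m)" if "x \<noteq> 0" for x
  proof (rule homogeneous_gradient_norm[OF _ f G fpos hom p(1) _ _ _ that, unfolded N])
    \<comment> \<open>The condition \<open>1 < p < n\<close> excludes \<open>n = 1\<close>; the
      positivity of \<open>c1\<close> rests on \<open>n - 1 > 0\<close>.\<close>
    show "DIM('a) \<ge> 3" using p n by linarith
  qed (use exps flat in \<open>auto simp: D_def\<close>)
  have "norm (G x) = (k / (real n - m)) powr (1 / p)" if "x \<noteq> 0" for x
    unfolding norm_G[OF that, symmetric] using p by (simp add: powr_powr)
  from homogeneous_constant_gradient_norm[OF f hom fpos Gx this]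
  have "\<forall>x\<in>sphere 0 1. f x = (k / (real n - m)) powr (1 / p)" by blast
  then show ?thesis
    unfolding constant_on_def using \<omega> by auto
qed

end
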